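(* Suppose assumptions (1)–(3) in the context hold, and consider the nonlinear power system (N) in the context under the distributed control law $\bm u=\bm F_d\widetilde{\bm x}$, $\widetilde{\bm x}=\bm x-\bm x^*$. If the closed-loop matrix satisfies $$\mathrm{spec}(\widetilde{\bm A}+\bm B\bm F_d)\subset\mathbb{C}^-=\{c\in\mathbb{C}\mid \mathrm{Re}(c)<0\},$$ with $\widetilde{\bm A},\bm B,\bm F_d$ as defined in the context, then the synchronous state $\bm x^*$ is a locally asymptotically stable equilibrium of the closed-loop nonlinear system.
   Context: **Network.** $\mathcal V_H=\mathcal L_5\cup\mathcal L_4\cup\mathcal L_3$ (disjoint) is the node set of a rooted tree with $n_H=111$ nodes: $\mathcal L_5$ consists of the root, $\mathcal L_4$ of its 10 children, and $\mathcal L_3$ of 100 nodes, 10 children for each node of $\mathcal L_4$. $\mathcal E$ is the (symmetric) set of pairs of adjacent nodes; $\sum_{(j,i)\in\mathcal E}$ (for fixed $i$) is the sum over neighbours $j$ of $i$. Susceptances $b_{ij}$, conductances $g_{ij}$, $b_{ij}=0$ if $(i,j)\notin\mathcal E$; $\theta_{ij}=\theta_i-\theta_j$; $P_i,Q_i$ are real constants. **Nonlinear system (N).** For $i\in\mathcal V_H$, $$\dot\theta_i=\omega_i,\quad m_i\dot\omega_i=-d_i\omega_i+P_i-\sum_{j\in\mathcal V_H}P_{i,j}(\theta,v)+u_{i,\omega},\quad \tau_i\dot v_i=-k_iv_i+Q_i-\sum_{j\in\mathcal V_H}Q_{i,j}(\theta,v)+u_{i,v},$$ $$P_{i,j}=v_iv_j[g_{ij}\cos\theta_{ij}+b_{ij}\sin\theta_{ij}],\quad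 Q_{i,j}=v_iv_j[g_{ij}\sin\theta_{ij}-b_{ij}\cos\theta_{ij}],$$ with inputs $\bm u_i=(u_{i,\omega},u_{i,v})^\top$, $\bm u=\mathrm{col}(\bm u_i)\in\mathbb{R}^{2n_H}$. A synchronous state $\bm x^*$, with components $(\theta_i^*,\omega_i^*,v_i^* )$, is an equilibrium for $\bm u=0$: $\omega_i^*=0$, $\sum_{(j,i)\in\mathcal E}P_{i,j}(\theta^*,v^* )=P_i$, $\sum_{(j,i)\in\mathcal E}Q_{i,j}(\theta^*,v^* )=Q_i-k_iv_i^*$. A reference node $g\in\mathcal L_3$ is fixed with $\theta_g=\theta_g^*$ at all times, so the equation for $\theta_g$ is dropped; the state deviation $\widetilde{\bm x}\in\mathbb{R}^{3n_H-1}$ has blocks $\widetilde{\bm x}_i=(\theta_i-\theta_i^*,\omega_i,v_i-v_i^* )^\top$ for $i\neq g$ and $\widetilde{\bm x}_g=(\omega_g,v_g-v_g^* )^\top$, and stability is understood in these coordinates (at $\widetilde{\bm x}=\bm 0$). **Assumptions.** (1) The network is connected and lossless: $b_{ij}=b_{ji}>0$ for $(i,j)\in\mathcal E$, $b_{ii}=0$, $g_{ij}=0$. (2) $|\theta_i^*-\theta_j^*|<\pi/2$ for $(i,j)\in\mathcal E$. (3) $m_i,d_i,\tau_i,k_i,v_i^*>0$ for all $i$, and $m_i>m_j>m_k$ for all $i\in\mathcal L_5,j\in\mathcal L_4,k\in\mathcal L_3$. **Matrices.** $\widetilde{\bm A}=\bm A+\bm A^{\bm x}+\widehat{\bm A}\in\mathbb{R}^{(3n_H-1)\times(3n_H-1)}$,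 with $\bm A=\mathrm{diag}(\bm A_i)$, $\bm A^{\bm x}=\mathrm{diag}(\bm A_i^{\bm x})$ block diagonal, $\widehat{\bm A}=[\widehat{\bm A}_{ij}]$, and $\bm B=\mathrm{diag}(\bm B_i)\in\mathbb{R}^{(3n_H-1)\times2n_H}$, where $$\bm A_i=\begin{bmatrix}0&1&0\\0&-d_i/m_i&0\\0&0&-k_i/\tau_i\end{bmatrix},\quad \bm B_i=\begin{bmatrix}0&0\\1/m_i&0\\0&1/\tau_i\end{bmatrix},$$ $$\bm A_i^{\bm x}=\sum_{(j,i)\in\mathcal E}\begin{bmatrix}0&0&0\\-\frac{b_{ij}v_i^*v_j^*\cos\theta_{ij}^*}{m_i}&0&-\frac{b_{ij}v_j^*\sin\theta_{ij}^*}{m_i}\\-\frac{b_{ij}v_i^*v_j^*\sin\theta_{ij}^*}{\tau_i}&0&\frac{b_{ij}v_j^*\cos\theta_{ij}^*}{\tau_i}\end{bmatrix},$$ $$\widehat{\bm A}_{ij}=\begin{bmatrix}0&0&0\\\frac{b_{ij}v_i^*v_j^*\cos\theta_{ij}^*}{m_i}&0&-\frac{b_{ij}v_i^*\sin\theta_{ij}^*}{m_i}\\\frac{b_{ij}v_i^*v_j^*\sin\theta_{ij}^*}{\tau_i}&0&\frac{b_{ij}v_i^*\cos\theta_{ij}^*}{\tau_i}\end{bmatrix}\ \text{for }(i,j)\in\mathcal E,\quad \widehat{\bm A}_{ij}=0\ \text{otherwise}.$$ For the reference node $g$ the row and/or column belonging to $\theta_g$ is deleted from each block (e.g. $\bm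 A_g=\mathrm{diag}(-d_g/m_g,-k_g/\tau_g)$, $\bm B_g=\mathrm{diag}(1/m_g,1/\tau_g)$). $\widetilde{\bm A}$ is the Jacobian at $\bm x^*$ of the uncontrolled system (N) in the coordinates $\widetilde{\bm x}$. **Distributed control law.** For each $i$, $\bm Q_{\bm u\bm u,i}\in\mathbb{R}^{2\times2}$ is a diagonal positive definite matrix and $\bm Q_{\bm x\bm x,i}=\bm C_i^\top\bm C_i$, with $\bm C_i=\mathrm{diag}(C_i^\theta,0,C_i^v)$, $C_i^\theta,C_i^v>0$ for $i\ne g$, and $\bm C_g$ a real diagonal $2\times2$ matrix. $\bm Q_i$ is a symmetric positive definite matrix ($3\times3$ for $i\neq g$, $2\times2$ for $i=g$) solving $$0=\bm Q_i\bm A_i+\bm A_i^\top\bm Q_i+\bm Q_{\bm x\bm x,i}-\bm Q_i\bm B_i\bm Q_{\bm u\bm u,i}^{-1}\bm B_i^\top\bm Q_i$$ and such that $\mathrm{spec}(\bm A_i+\bm B_i\bm F_{d,i})\subset\mathbb{C}^-$, where $\bm F_{d,i}=-\bm Q_{\bm u\bm u,i}^{-1}\bm B_i^\top\bm Q_i$. Then $\bm F_d=\mathrm{diag}(\bm F_{d,i})$ (block diagonal), i.e. $\bm u_i=\bm F_{d,i}\widetilde{\bm x}_i$. *)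

theory Defs
  imports "HOL-Analysis.Analysis"
begin

section \<open>Local asymptotic stability\<close>

definition solution_on :: "('a::real_normed_vector \<Rightarrow> 'a) \<Rightarrow> real set \<Rightarrow> (real \<Rightarrow> 'a) \<Rightarrow> bool"
  where "solution_on f I x \<longleftrightarrow>
    (\<forall>t\<in>I. (x has_vector_derivative f (x t)) (at t within I))"

text \<open>Forward existence is part of the notion, so that the two clauses about solutions are never
  vacuous; the stability clause also covers solutions that are only given on a bounded interval.\<close>

definition locally_asymptotically_stable :: "('a::real_normed_vector \<Rightarrow> 'a) \<Rightarrow> 'a \<Rightarrow> bool"
  where "locally_asymptotically_stable f e \<longleftrightarrow>
    f e = 0
    \<and> (\<exists>\<delta>>0. \<forall>x0. dist x0 e < \<delta> \<longrightarrow> (\<exists>x. x 0 = x0 \<and> solution_on f {0..} x))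
    \<and> (\<forall>\<epsilon>>0. \<exists>\<delta>>0. \<forall>x T. solution_on f {0..<T} x \<and> dist (x 0) e < \<delta> \<longrightarrow>
          (\<forall>t\<in>{0..<T}. dist (x t) e < \<epsilon>))
    \<and> (\<exists>\<delta>>0. \<forall>x. solution_on f {0..} x \<and> dist (x 0) e < \<delta> \<longrightarrow> (x \<longlongrightarrow> e) at_top)"

section \<open>Matrices\<close>

definition spec :: "real^'k^'k \<Rightarrow> complex set"
  where "spec M = {c. \<exists>w::complex^'k. w \<noteq> 0 \<and> map_matrix complex_of_real M *v w = c *s w}"

definition left_half_plane :: "complex set"
  where "left_half_plane = {c. Re c < 0}"

definition diagonal :: "real^'k^'k \<Rightarrow> bool"
  where "diagonal M \<longleftrightarrow> (\<forall>i j. i \<noteq> j \<longrightarrow> M $ i $ j = 0)"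

definition pos_definite :: "real^'k^'k \<Rightarrow> bool"
  where "pos_definite M \<longleftrightarrow> transpose M = M \<and> (\<forall>w. w \<noteq> 0 \<longrightarrow> w \<bullet> (M *v w) > 0)"

definition riccati_solution ::
  "real^'k^'k \<Rightarrow> real^'l^'k \<Rightarrow> real^'k^'k \<Rightarrow> real^'l^'l \<Rightarrow> real^'k^'k \<Rightarrow> bool"
  where "riccati_solution A B Qxx Quu Q \<longleftrightarrow>
    0 = Q ** A + transpose A ** Q + Qxx - Q ** B ** matrix_inv Quu ** transpose B ** Q"

definition lqr_gain :: "real^'l^'k \<Rightarrow> real^'l^'l \<Rightarrow> real^'k^'k \<Rightarrow> real^'k^'l"
  where "lqr_gain B Quu Q = - (matrix_inv Quu ** transpose B ** Q)"

section \<open>The network\<close>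

text \<open>The type \<open>'n\<close> is the node set.\<close>

definition hierarchical_tree :: "'n set \<Rightarrow> 'n set \<Rightarrow> 'n set \<Rightarrow> ('n::finite \<times> 'n) set \<Rightarrow> bool"
  where "hierarchical_tree L5 L4 L3 E \<longleftrightarrow>
    CARD('n) = 111 \<and> L5 \<union> L4 \<union> L3 = UNIV
    \<and> L5 \<inter> L4 = {} \<and> L5 \<inter> L3 = {} \<and> L4 \<inter> L3 = {}
    \<and> card L4 = 10 \<and> card L3 = 100
    \<and> (\<exists>root parent. L5 = {root}
        \<and> (\<forall>i\<in>L4. parent i = root)
        \<and> (\<forall>i\<in>L3. parent i \<in> L4)
        \<and> (\<forall>j\<in>L4. card {i\<in>L3. parent i = j} = 10)
        \<and> E = {(i, j). (i \<in> L4 \<union> L3 \<and> j = parent i) \<or> (j \<in> L4 \<union> L3 \<and> i = parent j)})"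

record 'n network =
  edges :: "('n \<times> 'n) set"
  susc :: "'n \<Rightarrow> 'n \<Rightarrow> real"
  cond :: "'n \<Rightarrow> 'n \<Rightarrow> real"
  inertia :: "'n \<Rightarrow> real"
  damping :: "'n \<Rightarrow> real"
  tconst :: "'n \<Rightarrow> real"
  vdecay :: "'n \<Rightarrow> real"
  pconst :: "'n \<Rightarrow> real"
  qconst :: "'n \<Rightarrow> real"

record 'n pstate =
  angle :: "'n \<Rightarrow> real"
  freq :: "'n \<Rightarrow> real"
  volt :: "'n \<Rightarrow> real"

definition angle_diff :: "'n pstate \<Rightarrow> 'n \<Rightarrow> 'n \<Rightarrow> real"
  where "angle_diff x i j = angle x i - angle x j"

definition active_power :: "'n network \<Rightarrow> 'n pstate \<Rightarrow> 'n \<Rightarrow> 'n \<Rightarrow> real"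
  where "active_power N x i j =
    volt x i * volt x j *
      (cond N i j * cos (angle_diff x i j) + susc N i j * sin (angle_diff x i j))"

definition reactive_power :: "'n network \<Rightarrow> 'n pstate \<Rightarrow> 'n \<Rightarrow> 'n \<Rightarrow> real"
  where "reactive_power N x i j =
    volt x i * volt x j *
      (cond N i j * sin (angle_diff x i j) - susc N i j * cos (angle_diff x i j))"

definition neighbours :: "'n network \<Rightarrow> 'n \<Rightarrow> 'n set"
  where "neighbours N i = {j. (j, i) \<in> edges N}"

definition synchronous_state :: "'n::finite network \<Rightarrow> 'n pstate \<Rightarrow> bool"
  where "synchronous_state N xs \<longleftrightarrow>
    (\<forall>i. freq xs i = 0
      \<and> (\<Sum>j\<in>neighbours N i. active_power N xs i j) = pconst N i
      \<and> (\<Sum>j\<in>neighbours N i. reactive_power N xs i j) = qconst N i - vdecay N i * volt xs i)"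

text \<open>Right-hand side of the controlled network at node \<open>i\<close>, solved for the derivatives of angle,
  frequency and voltage (components 1, 2, 3).\<close>

definition node_rhs :: "'n::finite network \<Rightarrow> 'n pstate \<Rightarrow> ('n \<Rightarrow> real^2) \<Rightarrow> 'n \<Rightarrow> real^3"
  where "node_rhs N x u i = vector [
    freq x i,
    (- damping N i * freq x i + pconst N i - (\<Sum>j\<in>UNIV. active_power N x i j) + u i $ 1)
      / inertia N i,
    (- vdecay N i * volt x i + qconst N i - (\<Sum>j\<in>UNIV. reactive_power N x i j) + u i $ 2)
      / tconst N i]"

definition connected_lossless :: "'n network \<Rightarrow> bool"
  where "connected_lossless N \<longleftrightarrow>
    (\<forall>i j. (i, j) \<in> (edges N)\<^sup>*)
    \<and> (\<forall>(i, j)\<in>edges N. susc N i j = susc N j i \<and> susc N i j > 0)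
    \<and> (\<forall>i. susc N i i = 0)
    \<and> (\<forall>i j. (i, j) \<notin> edges N \<longrightarrow> susc N i j = 0)
    \<and> (\<forall>i j. cond N i j = 0)"

definition positive_parameters ::
  "'n set \<Rightarrow> 'n set \<Rightarrow> 'n set \<Rightarrow> 'n network \<Rightarrow> 'n pstate \<Rightarrow> bool"
  where "positive_parameters L5 L4 L3 N xs \<longleftrightarrow>
    (\<forall>i. inertia N i > 0 \<and> damping N i > 0 \<and> tconst N i > 0 \<and> vdecay N i > 0 \<and> volt xs i > 0)
    \<and> (\<forall>i\<in>L5. \<forall>j\<in>L4. \<forall>k\<in>L3. inertia N i > inertia N j \<and> inertia N j > inertia N k)"

section \<open>Reduced coordinates\<close>

text \<open>A coordinate is a pair of a node and a component in \<open>{1, 2, 3}\<close> (angle, frequency, voltage);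
  the pair \<open>(g, 1)\<close> is left out. The type \<open>'s\<close>, which therefore has \<open>3 * CARD('n) - 1\<close> elements,
  indexes the coordinates through an arbitrary enumeration \<open>c\<close>. Input coordinates are indexed
  by \<open>'n \<times> 2\<close>.\<close>

definition coordinates :: "'n \<Rightarrow> ('s \<Rightarrow> 'n \<times> 3) \<Rightarrow> bool"
  where "coordinates g c \<longleftrightarrow> bij_betw c UNIV (UNIV - {(g, 1)})"

definition deviation :: "'n \<Rightarrow> ('s \<Rightarrow> 'n \<times> 3) \<Rightarrow> real^'s \<Rightarrow> 'n \<Rightarrow> 3 \<Rightarrow> real"
  where "deviation g c z i a = (if (i, a) = (g, 1) then 0 else z $ (inv c (i, a)))"

definition state_at :: "'n \<Rightarrow> ('s \<Rightarrow> 'n \<times> 3) \<Rightarrow> 'n pstate \<Rightarrow> real^'s \<Rightarrow> 'n pstate"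
  where "state_at g c xs z =
    \<lparr>angle = \<lambda>i. angle xs i + deviation g c z i 1,
     freq = \<lambda>i. freq xs i + deviation g c z i 2,
     volt = \<lambda>i. volt xs i + deviation g c z i 3\<rparr>"

definition controlled_field ::
  "'n::finite network \<Rightarrow> 'n \<Rightarrow> ('s::finite \<Rightarrow> 'n \<times> 3) \<Rightarrow> 'n pstate \<Rightarrow> real^'s \<Rightarrow> real^('n \<times> 2) \<Rightarrow> real^'s"
  where "controlled_field N g c xs z u =
    (\<chi> s. node_rhs N (state_at g c xs z) (\<lambda>i. \<chi> k. u $ (i, k)) (fst (c s)) $ snd (c s))"

section \<open>Linearisation\<close>

definition A_node :: "'n network \<Rightarrow> 'n \<Rightarrow> real^3^3"
  where "A_node N i = vector [
    vector [0, 1, 0],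
    vector [0, - damping N i / inertia N i, 0],
    vector [0, 0, - vdecay N i / tconst N i]]"

definition B_node :: "'n network \<Rightarrow> 'n \<Rightarrow> real^2^3"
  where "B_node N i = vector [
    vector [0, 0],
    vector [1 / inertia N i, 0],
    vector [0, 1 / tconst N i]]"

definition Ax_node :: "'n::finite network \<Rightarrow> 'n pstate \<Rightarrow> 'n \<Rightarrow> real^3^3"
  where "Ax_node N xs i = (\<Sum>j\<in>neighbours N i. vector [
    vector [0, 0, 0],
    vector [- (susc N i j * volt xs i * volt xs j * cos (angle_diff xs i j) / inertia N i), 0,
            - (susc N i j * volt xs j * sin (angle_diff xs i j) / inertia N i)],
    vector [- (susc N i j * volt xs i * volt xs j * sin (angle_diff xs i j) / tconst N i), 0,
            susc N i j * volt xs j * cos (angle_diff xs i j) / tconst N i]])"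

definition Ahat_block :: "'n network \<Rightarrow> 'n pstate \<Rightarrow> 'n \<Rightarrow> 'n \<Rightarrow> real^3^3"
  where "Ahat_block N xs i j = (if (i, j) \<in> edges N then vector [
    vector [0, 0, 0],
    vector [susc N i j * volt xs i * volt xs j * cos (angle_diff xs i j) / inertia N i, 0,
            - (susc N i j * volt xs i * sin (angle_diff xs i j) / inertia N i)],
    vector [susc N i j * volt xs i * volt xs j * sin (angle_diff xs i j) / tconst N i, 0,
            susc N i j * volt xs i * cos (angle_diff xs i j) / tconst N i]]
    else 0)"

definition A_ref :: "'n network \<Rightarrow> 'n \<Rightarrow> real^2^2"
  where "A_ref N g = vector [
    vector [- damping N g / inertia N g, 0],
    vector [0, - vdecay N g / tconst N g]]"

definition B_ref :: "'n network \<Rightarrow> 'n \<Rightarrow> real^2^2"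
  where "B_ref N g = vector [vector [1 / inertia N g, 0], vector [0, 1 / tconst N g]]"

text \<open>Since \<open>(g, 1)\<close> is not in the range of \<open>c\<close>, assembling \<open>3 \<times> 3\<close> and \<open>3 \<times> 2\<close> blocks along \<open>c\<close>
  deletes the row and column of the reference angle.\<close>

definition state_blocks :: "('s::finite \<Rightarrow> 'n \<times> 3) \<Rightarrow> ('n \<Rightarrow> 'n \<Rightarrow> real^3^3) \<Rightarrow> real^'s^'s"
  where "state_blocks c M = (\<chi> s t. M (fst (c s)) (fst (c t)) $ snd (c s) $ snd (c t))"

definition block_diag :: "('n \<Rightarrow> 'b::zero) \<Rightarrow> 'n \<Rightarrow> 'n \<Rightarrow> 'b"
  where "block_diag D i j = (if i = j then D i else 0)"

definition A_tilde :: "'n::finite network \<Rightarrow> ('s::finite \<Rightarrow> 'n \<times> 3) \<Rightarrow> 'n pstate \<Rightarrow> real^'s^'s"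
  where "A_tilde N c xs =
    state_blocks c (block_diag (A_node N)) + state_blocks c (block_diag (Ax_node N xs))
    + state_blocks c (Ahat_block N xs)"

definition B_full :: "'n::finite network \<Rightarrow> ('s::finite \<Rightarrow> 'n \<times> 3) \<Rightarrow> real^('n \<times> 2)^'s"
  where "B_full N c = (\<chi> s r. block_diag (B_node N) (fst (c s)) (fst r) $ snd (c s) $ snd r)"

section \<open>Distributed control\<close>

text \<open>The matrices \<open>Q i\<close> matter for \<open>i \<noteq> g\<close> only; at the reference node \<open>g\<close> the \<open>2 \<times> 2\<close> matrices
  \<open>Cg\<close> and \<open>Qg\<close> are used.\<close>

definition C_node :: "real \<Rightarrow> real \<Rightarrow> real^3^3"
  where "C_node ct cv = vector [vector [ct, 0, 0], vector [0, 0, 0], vector [0, 0, cv]]"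

definition F_node :: "'n network \<Rightarrow> ('n \<Rightarrow> real^2^2) \<Rightarrow> ('n \<Rightarrow> real^3^3) \<Rightarrow> 'n \<Rightarrow> real^3^2"
  where "F_node N Quu Q i = lqr_gain (B_node N i) (Quu i) (Q i)"

definition F_ref :: "'n network \<Rightarrow> ('n \<Rightarrow> real^2^2) \<Rightarrow> real^2^2 \<Rightarrow> 'n \<Rightarrow> real^2^2"
  where "F_ref N Quu Qg g = lqr_gain (B_ref N g) (Quu g) Qg"

definition distributed_design ::
  "'n network \<Rightarrow> 'n \<Rightarrow> ('n \<Rightarrow> real^2^2) \<Rightarrow> ('n \<Rightarrow> real) \<Rightarrow> ('n \<Rightarrow> real) \<Rightarrow> real^2^2
    \<Rightarrow> ('n \<Rightarrow> real^3^3) \<Rightarrow> real^2^2 \<Rightarrow> bool"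
  where "distributed_design N g Quu Ct Cv Cg Q Qg \<longleftrightarrow>
    (\<forall>i. diagonal (Quu i) \<and> pos_definite (Quu i))
    \<and> (\<forall>i. i \<noteq> g \<longrightarrow>
        Ct i > 0 \<and> Cv i > 0 \<and> pos_definite (Q i)
        \<and> riccati_solution (A_node N i) (B_node N i)
            (transpose (C_node (Ct i) (Cv i)) ** C_node (Ct i) (Cv i)) (Quu i) (Q i)
        \<and> spec (A_node N i + B_node N i ** F_node N Quu Q i) \<subseteq> left_half_plane)
    \<and> diagonal Cg \<and> pos_definite Qg
    \<and> riccati_solution (A_ref N g) (B_ref N g) (transpose Cg ** Cg) (Quu g) Qg
    \<and> spec (A_ref N g + B_ref N g ** F_ref N Quu Qg g) \<subseteq> left_half_plane"

text \<open>The columns 1, 2 of the block of \<open>g\<close> belong to the components 2, 3 (frequency, voltage).\<close>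

definition F_full ::
  "'n::finite network \<Rightarrow> 'n \<Rightarrow> ('s::finite \<Rightarrow> 'n \<times> 3) \<Rightarrow> ('n \<Rightarrow> real^2^2)
    \<Rightarrow> ('n \<Rightarrow> real^3^3) \<Rightarrow> real^2^2 \<Rightarrow> real^'s^('n \<times> 2)"
  where "F_full N g c Quu Q Qg = (\<chi> r s.
    let i = fst (c s); a = snd (c s) in
      if fst r \<noteq> i then 0
      else if i = g then F_ref N Quu Qg g $ snd r $ (if a = 2 then 1 else 2)
      else F_node N Quu Q i $ snd r $ a)"

end

(* The Jacobian of the closed loop at the state with deviation z is A_tilde + B F with A_tilde
   evaluated at that state, so the field is C^1 and its remainder after linearisation at the
   equilibrium has arbitrarily small Lipschitz constant near 0. A Hurwitz matrix is strictly
   dissipative for a suitable inner product: triangularise its transpose by linear functionals and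
   scale each new functional so small that the off-diagonal terms are absorbed. That inner product
   is a strict Lyapunov function of the nonlinear field on a ball, hence traps solutions that start
   close to 0 and makes them decay exponentially. Solutions exist for all time because the field,
   precomposed with the projection onto the ball, is globally Lipschitz. *)
theory Submission
  imports Defs "HOL-Computational_Algebra.Fundamental_Theorem_Algebra"
begin

section \<open>Inner products adapted to a Hurwitz matrix\<close>

text \<open>The inner product is to come from a sum of squares |b(x)|^2 of linear functionals b.
  Along x' = M x the number b(x) has derivative (M^T b)(x), so it is the transpose that must be
  triangular with respect to the b. Eigenvalues, and hence functionals, may be complex; taking real
  parts at the end gives a real form. Triangular form is enough because strictly negative real parts
  leave room for off-diagonal terms, whether or not M is diagonalisable. Stability is claimed for
  arbitrary solutions, some given only on a bounded half-open interval, while existence is claimed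
  for all forward time. The trapping estimate is therefore proved for any given solution of any
  field that is dissipative on the ball, and is applied both to the original field and to its
  projected version. The Lipschitz form of the remainder serves twice: comparison with the point 0
  yields dissipation, and comparison of two free points yields the Lipschitz bound on which
  existence rests.\<close>

definition poly_act :: "complex^'k^'k \<Rightarrow> complex^'k \<Rightarrow> complex poly \<Rightarrow> complex^'k"
  where "poly_act S v p = (\<Sum>i\<le>degree p. coeff p i *s (((*v) S) ^^ i) v)"

lemma poly_act_0: "poly_act S v 0 = 0"
  by (simp add: poly_act_def)

lemma matrix_vector_mult_sum_right: "(S::'a::comm_ring_1^'n^'m) *v (\<Sum>i\<in>I. f i) = (\<Sum>i\<in>I. S *v f i)"
  by (induction I rule: infinite_finite_induct) (simp_all add: matrix_vector_right_distrib)

text \<open>\<open>poly_act S v p\<close> is p(S) v, and this is its Horner recursion. It carries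
  the inductions below, where the upper limit \<open>degree p\<close> of the defining sum would get
  in the way because degrees can drop under addition.\<close>

lemma poly_act_pCons: "poly_act S v (pCons a p) = a *s v + S *v poly_act S v p"
proof (cases "p = 0")
  case True
  then show ?thesis by (simp add: poly_act_def)
next
  case False
  then have "poly_act S v (pCons a p) = (\<Sum>i\<le>Suc (degree p). coeff (pCons a p) i *s (((*v) S) ^^ i) v)"
    by (simp add: poly_act_def)
  also have "\<dots> = a *s v + (\<Sum>i\<le>degree p. coeff p i *s (S *v (((*v) S) ^^ i) v))"
    by (subst sum.atMost_Suc_shift) simp
  also have "\<dots> = a *s v + S *v poly_act S v p"
    by (simp add: poly_act_def matrix_vector_mult_sum_right vector_scalar_commute)
  finally show ?thesis .
qed

lemma poly_act_add: "poly_act S v (p + q) = poly_act S v p + poly_act S v q"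
  by (induction p q rule: poly_induct2)
    (simp_all add: poly_act_pCons poly_act_0 matrix_vector_right_distrib vector_sadd_rdistrib)

lemma poly_act_smult: "poly_act S v (smult a p) = a *s poly_act S v p"
  by (induction p)
    (simp_all add: poly_act_pCons poly_act_0 vector_scalar_commute vector_add_ldistrib vector_smult_assoc)

lemma poly_act_sum: "poly_act S v (\<Sum>i\<in>I. f i) = (\<Sum>i\<in>I. poly_act S v (f i))"
  by (induction I rule: infinite_finite_induct) (simp_all add: poly_act_0 poly_act_add)

lemma poly_act_monom: "poly_act S v (monom a i) = a *s (((*v) S) ^^ i) v"
proof (induction i)
  case 0
  then show ?case by (simp add: monom_0 poly_act_pCons poly_act_0)
next
  case (Suc i)
  then show ?case by (simp add: monom_Suc poly_act_pCons vector_scalar_commute)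
qed

text \<open>One more iterate v, S v, S^2 v, ... than the dimension cannot be independent; the
  coefficients of a linear relation form the polynomial.\<close>

lemma poly_act_annihilator:
  fixes S :: "complex^'k^'k"
  obtains p where "p \<noteq> 0" "poly_act S v p = 0"
proof -
  define f where "f i = (((*v) S) ^^ i) v" for i
  define I where "I = {..CARD('k)}"
  show ?thesis
  \<comment> \<open>Dependence is a property of sets, so a repeated iterate is invisible to it. A
    repetition \<open>f i = f j\<close> yields X^i - X^j directly; otherwise the iterates form a set
    of \<open>CARD('k) + 1\<close> elements.\<close>
  proof (cases "inj_on f I")
    case False
    then obtain i j where ij: "i \<noteq> j" "f i = f j"
      by (auto simp: inj_on_def)
    let ?p = "monom 1 i + monom (-1) j :: complex poly"
    have "coeff ?p i = 1"
      using ij by simp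
    then have "?p \<noteq> 0"
      by (metis coeff_0 zero_neq_one)
    moreover have "poly_act S v ?p = 0"
      using ij by (simp add: poly_act_add poly_act_monom f_def)
    ultimately show ?thesis using that by blast
  next
    case True
    have "card (f ` I) = Suc CARD('k)"
      using True by (simp add: card_image I_def)
    moreover have "card (f ` I) \<le> CARD('k)" if "vec.independent (f ` I)"
      using vec.independent_card_le_dim[of "f ` I" UNIV] that by (simp add: card_cart_basis)
    ultimately have "vec.dependent (f ` I)"
      by fastforce
    then obtain u where u: "\<exists>x\<in>f ` I. u x \<noteq> 0" "(\<Sum>x\<in>f ` I. u x *s x) = 0"
      by (subst (asm) vec.dependent_finite) (auto simp: I_def)
    let ?p = "\<Sum>i\<in>I. monom (u (f i)) i"
    obtain i where i: "i \<in> I" "u (f i) \<noteq> 0"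
      using u(1) by auto
    have "coeff ?p i = (\<Sum>j\<in>I. if j = i then u (f j) else 0)"
      by (simp add: coeff_sum)
    also have "\<dots> = u (f i)"
      using i by (simp add: I_def)
    finally have "?p \<noteq> 0"
      using i by (metis coeff_0)
    moreover have "poly_act S v ?p = 0"
      using u(2) True by (simp add: poly_act_sum poly_act_monom sum.reindex flip: f_def)
    ultimately show ?thesis using that by blast
  qed
qed

lemma mat_vector_mult: "mat l *v (x :: 'a::comm_ring_1^'k) = l *s x"
  by (simp add: matrix_vector_mult_def mat_def vec_eq_iff if_distrib if_distribR cong: if_cong)

text \<open>Take v outside U and p of least degree among the nonzero polynomials with p(S) v in U. A
  root l gives p = (X - l) q and w = q(S) v: minimality keeps w out of U, while (S - l) w = p(S) v
  lies in U. The last conclusion makes l an eigenvalue of S itself and not just of the induced map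
  on the quotient, so that a spectral hypothesis on S applies to it.\<close>

lemma eigenvector_modulo_invariant_subspace:
  fixes S :: "complex^'k^'k"
  assumes U: "vec.subspace U" and inv: "\<And>u. u \<in> U \<Longrightarrow> S *v u \<in> U" and "U \<noteq> UNIV"
  obtains w l where "w \<notin> U" "S *v w - l *s w \<in> U" "\<exists>u. u \<noteq> 0 \<and> S *v u = l *s u"
proof -
  obtain v where v: "v \<notin> U" using \<open>U \<noteq> UNIV\<close> by auto
  obtain p0 where "p0 \<noteq> 0" "poly_act S v p0 = 0"
    by (rule poly_act_annihilator)
  then have "p0 \<noteq> 0 \<and> poly_act S v p0 \<in> U"
    using vec.subspace_0[OF U] by simp
  then obtain p where p: "p \<noteq> 0" "poly_act S v p \<in> U"
    and least: "\<And>q. q \<noteq> 0 \<Longrightarrow> poly_act S v q \<in> U \<Longrightarrow> degree p \<le> degree q"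
    using ex_has_least_nat[of "\<lambda>p. p \<noteq> 0 \<and> poly_act S v p \<in> U" p0 degree] by blast
  have "degree p \<noteq> 0"
  proof
    assume "degree p = 0"
    then obtain a where a: "p = [:a:]" by (rule degree_eq_zeroE)
    with p have "a \<noteq> 0" "a *s v \<in> U"
      by (auto simp: poly_act_pCons poly_act_0)
    then have "inverse a *s (a *s v) \<in> U"
      using vec.subspace_scale[OF U] by blast
    with v \<open>a \<noteq> 0\<close> show False by (simp add: vector_smult_assoc)
  qed
  then have "\<not> constant (poly p)"
    by (simp add: constant_degree)
  then obtain l where "poly p l = 0"
    using fundamental_theorem_of_algebra by blast
  then obtain q where q: "p = [:- l, 1:] * q"
    unfolding poly_eq_0_iff_dvd by auto
  with p have "q \<noteq> 0" by auto
  then have "degree p = Suc (degree q)"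
    unfolding q by (subst degree_mult_eq) auto
  with least[of q] \<open>q \<noteq> 0\<close> have w: "poly_act S v q \<notin> U" by auto
  have "p = smult (- l) q + pCons 0 q"
    by (simp add: q)
  then have "poly_act S v p = S *v poly_act S v q - l *s poly_act S v q"
    by (simp add: poly_act_add poly_act_smult poly_act_pCons del: smult_minus_left)
  with p have wl: "S *v poly_act S v q - l *s poly_act S v q \<in> U" by simp
  \<comment> \<open>Otherwise S - l is injective and, by dimension, maps U onto U. Then (S - l) w
    has a preimage in U, which injectivity identifies with w.\<close>
  have "\<exists>u. u \<noteq> 0 \<and> S *v u = l *s u"
  proof (rule ccontr)
    assume no: "\<not> ?thesis"
    define T where "T = S - mat l"
    have T: "T *v u = S *v u - l *s u" for u
      by (simp add: T_def matrix_vector_mult_diff_rdistrib mat_vector_mult)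
    have lin: "Vector_Spaces.linear (*s) (*s) ((*v) T)"
      by (rule matrix_vector_mul_linear_gen)
    have inj: "inj ((*v) T)"
      using no by (auto simp: vec.inj_iff_eq_0 T)
    have sub: "(*v) T ` U \<subseteq> U"
      using inv vec.subspace_diff[OF U] vec.subspace_scale[OF U] by (auto simp: T)
    have "vec.dim ((*v) T ` U) = vec.dim U"
      using vec.dim_image_eq[OF lin, of U] inj by (meson inj_on_subset subset_UNIV)
    then have "(*v) T ` U = U"
      using vec.subspace_dim_equal[OF vec.linear_subspace_image[OF lin U] U sub] by simp
    then obtain u where "u \<in> U" "T *v poly_act S v q = T *v u"
      using wl unfolding T[symmetric] by auto
    then have "poly_act S v q \<in> U"
      using inj by (auto dest: injD)
    with w show False by simp
  qed
  with w wl that show ?thesis by blast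
qed

section \<open>Linear functionals and a dissipative triangular form\<close>

definition pairing :: "complex^'k \<Rightarrow> complex^'k \<Rightarrow> complex"
  where "pairing b w = (\<Sum>i\<in>UNIV. b $ i * w $ i)"

lemma pairing_simps:
  "pairing (a + b) w = pairing a w + pairing b w"
  "pairing (l *s b) w = l * pairing b w"
  "pairing b (w + z) = pairing b w + pairing b z"
  "pairing b (l *s w) = l * pairing b w"
  by (simp_all add: pairing_def algebra_simps sum.distrib sum_distrib_left)

lemma pairing_sum: "pairing (\<Sum>b\<in>B. f b) w = (\<Sum>b\<in>B. pairing (f b) w)"
  by (simp add: pairing_def sum_distrib_right sum.swap[of _ B])

text \<open>The pairing is bilinear, without conjugation, so that b represents a complex linear
  functional and the transpose acts on functionals by precomposition with M.\<close>

lemma pairing_transpose: "pairing (transpose M *v b) w = pairing b (M *v w)"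
  by (simp add: pairing_def matrix_vector_mult_def transpose_def sum_distrib_left sum_distrib_right
      mult_ac sum.swap[of "\<lambda>i j. b $ j * _ i j"]) (subst sum.swap, simp)

text \<open>Cauchy-Schwarz on the coefficients of u in terms of B; the constant K does not depend on
  w. This bounds the off-diagonal terms in \<open>stable_triangular_form\<close>, and later shows
  that a vector killed by a spanning B is killed by every functional.\<close>

lemma pairing_span_bound:
  assumes "finite B" "u \<in> vec.span B"
  obtains K where "K \<ge> 0" "\<And>w. (cmod (pairing u w))\<^sup>2 \<le> K * (\<Sum>b\<in>B. (cmod (pairing b w))\<^sup>2)"
proof -
  obtain a where u: "u = (\<Sum>b\<in>B. a b *s b)"
    using assms by (auto simp: vec.span_finite)
  have "(cmod (pairing u w))\<^sup>2 \<le> (\<Sum>b\<in>B. (cmod (a b))\<^sup>2) * (\<Sum>b\<in>B. (cmod (pairing b w))\<^sup>2)" for w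
  proof -
    have "cmod (pairing u w) \<le> (\<Sum>b\<in>B. cmod (a b) * cmod (pairing b w))"
      unfolding u pairing_sum pairing_simps
      by (rule order_trans[OF norm_sum]) (simp add: norm_mult)
    then have "(cmod (pairing u w))\<^sup>2 \<le> (\<Sum>b\<in>B. cmod (a b) * cmod (pairing b w))\<^sup>2"
      by (intro power_mono) auto
    also have "\<dots> \<le> (\<Sum>b\<in>B. (cmod (a b))\<^sup>2) * (\<Sum>b\<in>B. (cmod (pairing b w))\<^sup>2)"
      by (rule Cauchy_Schwarz_ineq_sum)
    finally show ?thesis .
  qed
  then show ?thesis by (intro that[of "\<Sum>b\<in>B. (cmod (a b))\<^sup>2"]) (auto intro: sum_nonneg)
qed

text \<open>The left-hand sum is half the derivative of the sum of |b(w)|^2 when w moves under the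
  transpose of S. Each induction step adds one functional v. Its image \<open>S *v v\<close> has the
  diagonal part l v with Re l < 0 and a part in the old span, which scaling v makes small against
  the rate a already secured. Invariance of the span is carried along so that the next step can be
  made.\<close>

lemma stable_triangular_form:
  fixes S :: "complex^'k^'k"
  assumes stable: "\<And>l u. u \<noteq> 0 \<Longrightarrow> S *v u = l *s u \<Longrightarrow> Re l < 0"
    and "k \<le> CARD('k)"
  shows "\<exists>B a. finite B \<and> vec.independent B \<and> card B = k \<and> (\<forall>u\<in>vec.span B. S *v u \<in> vec.span B)
    \<and> a > 0 \<and> (\<forall>w. (\<Sum>b\<in>B. Re (cnj (pairing b w) * pairing (S *v b) w))
                \<le> - a * (\<Sum>b\<in>B. (cmod (pairing b w))\<^sup>2))"
  using assms(2)
proof (induction k)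
  case 0
  show ?case
    by (intro exI[of _ "{}"] exI[of _ 1]) (auto simp: vec.independent_empty)
next
  case (Suc k)
  then obtain B a where B: "finite B" "vec.independent B" "card B = k"
    "\<And>u. u \<in> vec.span B \<Longrightarrow> S *v u \<in> vec.span B" "a > 0"
    and diss: "\<And>w. (\<Sum>b\<in>B. Re (cnj (pairing b w) * pairing (S *v b) w))
                \<le> - a * (\<Sum>b\<in>B. (cmod (pairing b w))\<^sup>2)"
    by (auto simp: Suc_le_eq)
  have "vec.span B \<noteq> UNIV"
  proof
    assume "vec.span B = UNIV"
    then have "vec.dim (UNIV :: (complex^'k) set) \<le> card B"
      using B(1) by (intro vec.dim_le_card) auto
    with B(3) Suc.prems show False by (simp add: card_cart_basis)
  qed
  then obtain w0 l where w0: "w0 \<notin> vec.span B" "S *v w0 - l *s w0 \<in> vec.span B"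
    and "\<exists>u. u \<noteq> 0 \<and> S *v u = l *s u"
    using eigenvector_modulo_invariant_subspace[OF vec.subspace_span B(4)] by metis
  then have l: "Re l < 0" using stable by blast
  define r where "r = - Re l"
  have r: "r > 0" "Re l = - r" using l by (auto simp: r_def)
  define u where "u = S *v w0 - l *s w0"
  obtain K where K: "K \<ge> 0"
    "\<And>w. (cmod (pairing u w))\<^sup>2 \<le> K * (\<Sum>b\<in>B. (cmod (pairing b w))\<^sup>2)"
    using pairing_span_bound[OF B(1), of u] w0(2) unfolding u_def by blast
  \<comment> \<open>Scaling by e multiplies the off-diagonal part by e and leaves l unchanged. This
    value brings \<open>e\<^sup>2 * K / (2 * r)\<close> below half of the old rate a;
    \<open>K + 1\<close> keeps the denominator positive when K = 0.\<close>
  define e where "e = sqrt (a * r / (K + 1))"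
  have e: "e > 0" "e\<^sup>2 = a * r / (K + 1)"
    using \<open>a > 0\<close> r K(1) by (auto simp: e_def)
  have eK: "e\<^sup>2 * K / (2 * r) \<le> a / 2"
  proof -
    have "e\<^sup>2 * K / (2 * r) = a / 2 * (K / (K + 1))"
      using r by (simp add: e(2))
    also have "\<dots> \<le> a / 2 * 1"
      using \<open>a > 0\<close> K(1) by (intro mult_left_mono) auto
    finally show ?thesis by simp
  qed
  define v where "v = of_real e *s w0"
  have Sv: "S *v v = l *s v + of_real e *s u"
    by (simp add: v_def u_def vector_scalar_commute vec_eq_iff algebra_simps)
  have v: "v \<notin> vec.span B"
  proof
    assume "v \<in> vec.span B"
    then have "inverse (of_real e) *s v \<in> vec.span B"
      by (rule vec.span_scale)
    then show False
      using w0(1) e(1) by (simp add: v_def vector_smult_assoc)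
  qed
  then have vB: "v \<notin> B" using vec.span_base by blast
  \<comment> \<open>Half of each of the rates a and r pays for the coupling; the smaller of the
    remaining halves is the new rate.\<close>
  define c where "c = min (a / 2) (r / 2)"
  have c: "c > 0" "c \<le> a / 2" "c \<le> r / 2" using \<open>a > 0\<close> r by (auto simp: c_def)
  have est: "(\<Sum>b\<in>insert v B. Re (cnj (pairing b w) * pairing (S *v b) w))
      \<le> - c * (\<Sum>b\<in>insert v B. (cmod (pairing b w))\<^sup>2)" for w
  proof -
    define V where "V = (\<Sum>b\<in>B. (cmod (pairing b w))\<^sup>2)"
    define x where "x = cmod (pairing v w)"
    define y where "y = cmod (pairing u w)"
    have V: "V \<ge> 0" by (simp add: V_def sum_nonneg)
    have "Re (cnj (pairing v w) * pairing (S *v v) w)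
        = Re (l * (pairing v w * cnj (pairing v w))) + Re (cnj (pairing v w) * (of_real e * pairing u w))"
      by (simp add: Sv pairing_simps algebra_simps)
    also have "Re (l * (pairing v w * cnj (pairing v w))) = - r * x\<^sup>2"
      by (simp add: complex_norm_square[symmetric] x_def r flip: of_real_power)
    also have "Re (cnj (pairing v w) * (of_real e * pairing u w)) \<le> x * (e * y)"
      using complex_Re_le_cmod[of "cnj (pairing v w) * (of_real e * pairing u w)"] e(1)
      by (simp add: norm_mult x_def y_def)
    \<comment> \<open>AM-GM: \<open>x e y \<le> r x\<^sup>2 / 2 + e\<^sup>2 y\<^sup>2 / (2 r)\<close>\<close>
    also have "- r * x\<^sup>2 + x * (e * y) \<le> - (r / 2) * x\<^sup>2 + e\<^sup>2 * y\<^sup>2 / (2 * r)"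
    proof -
      have "0 \<le> (r * x - e * y)\<^sup>2 / (2 * r)" using r by simp
      also have "\<dots> = r / 2 * x\<^sup>2 - x * (e * y) + e\<^sup>2 * y\<^sup>2 / (2 * r)"
        using r by (simp add: power2_eq_square field_simps)
      finally show ?thesis by (simp add: algebra_simps)
    qed
    also have "e\<^sup>2 * y\<^sup>2 / (2 * r) \<le> e\<^sup>2 * (K * V) / (2 * r)"
      using K(2)[of w] r by (intro divide_right_mono mult_left_mono) (auto simp: y_def V_def)
    also have "\<dots> = (e\<^sup>2 * K / (2 * r)) * V" by simp
    also have "\<dots> \<le> a / 2 * V"
      using eK V by (intro mult_right_mono) auto
    finally have "Re (cnj (pairing v w) * pairing (S *v v) w) \<le> - (r / 2) * x\<^sup>2 + a / 2 * V"
      by simp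
    moreover have "c * x\<^sup>2 \<le> r / 2 * x\<^sup>2" "c * V \<le> a / 2 * V"
      by (rule mult_right_mono; use c V in simp)+
    ultimately have "Re (cnj (pairing v w) * pairing (S *v v) w)
        + (\<Sum>b\<in>B. Re (cnj (pairing b w) * pairing (S *v b) w)) \<le> - c * (x\<^sup>2 + V)"
      using diss[of w] by (simp add: V_def[symmetric] algebra_simps)
    then show ?thesis
      using B(1) vB by (simp add: V_def x_def)
  qed
  have span: "S *v z \<in> vec.span (insert v B)" if z: "z \<in> vec.span (insert v B)" for z
  proof -
    have mono: "y \<in> vec.span (insert v B)" if "y \<in> vec.span B" for y
      using vec.span_mono[of B "insert v B"] that by auto
    obtain k where k: "z - k *s v \<in> vec.span B"
      using z vec.span_breakdown_eq by blast
    have "S *v z = k *s (l *s v + of_real e *s u) + S *v (z - k *s v)"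
      by (simp add: Sv[symmetric] vector_scalar_commute[symmetric] matrix_vector_right_distrib[symmetric])
    moreover have "u \<in> vec.span (insert v B)" using w0(2) by (simp add: u_def mono)
    moreover have "S *v (z - k *s v) \<in> vec.span (insert v B)" using k B(4) by (blast intro: mono)
    moreover have "v \<in> vec.span (insert v B)" by (simp add: vec.span_base)
    ultimately show ?thesis
      by (simp add: vec.span_add vec.span_scale)
  qed
  show ?case
    using B vB v c(1) est span
    by (intro exI[of _ "insert v B"] exI[of _ c])
      (simp add: vec.independent_insert)
qed

section \<open>From complex functionals to a real inner product\<close>

lemma eigenvalue_transpose:
  fixes M :: "complex^'k^'k"
  assumes "u \<noteq> 0" "transpose M *v u = l *s u"
  shows "\<exists>w. w \<noteq> 0 \<and> M *v w = l *s w"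
proof -
  \<comment> \<open>A nontrivial kernel means a vanishing determinant, a condition that
    transposition preserves.\<close>
  have ker: "(\<exists>x. x \<noteq> 0 \<and> A *v x = 0) \<longleftrightarrow> det A = 0" for A :: "complex^'k^'k"
    using invertible_det_nz[of A] by (metis invertible_left_inverse matrix_left_invertible_ker)
  have "(transpose M - mat l) *v u = 0"
    using assms(2) by (simp add: matrix_vector_mult_diff_rdistrib mat_vector_mult)
  with assms(1) have "det (transpose M - mat l) = 0" using ker by blast
  also have "transpose M - mat l = transpose (M - mat l)"
    by (simp add: transpose_def mat_def vec_eq_iff)
  finally have "det (M - mat l) = 0" by (simp add: det_transpose)
  then obtain w where "w \<noteq> 0" "(M - mat l) *v w = 0" using ker by blast
  then show ?thesis
    by (auto simp: matrix_vector_mult_diff_rdistrib mat_vector_mult)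
qed

definition complex_vec :: "real^'k \<Rightarrow> complex^'k"
  where "complex_vec z = (\<chi> i. complex_of_real (z $ i))"

lemma complex_vec_mult:
  "map_matrix complex_of_real M *v complex_vec z = complex_vec (M *v z)"
  by (simp add: complex_vec_def matrix_vector_mult_def vec_eq_iff map_matrix_def)

text \<open>The form is the real part of a Hermitian sum over the functionals in B, hence symmetric
  and real bilinear. It is definite because \<open>CARD('k)\<close> independent functionals span all
  of them and so separate points.\<close>

lemma hurwitz_inner_product:
  fixes M :: "real^'k^'k"
  assumes "spec M \<subseteq> left_half_plane"
  obtains ip :: "real^'k \<Rightarrow> real^'k \<Rightarrow> real" and a where
    "bounded_bilinear ip" "\<And>x y. ip x y = ip y x" "\<And>x. x \<noteq> 0 \<Longrightarrow> ip x x > 0"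
    "a > 0" "\<And>x. ip x (M *v x) \<le> - a * ip x x"
proof -
  define S where "S = transpose (map_matrix complex_of_real M)"
  have S: "pairing (S *v b) (complex_vec x) = pairing b (complex_vec (M *v x))" for b x
    unfolding S_def pairing_transpose complex_vec_mult ..
  have "Re l < 0" if "u \<noteq> 0" "S *v u = l *s u" for l u
    using eigenvalue_transpose[OF that[unfolded S_def]] assms
    by (auto simp: spec_def left_half_plane_def)
  then obtain B a where B: "finite B" "vec.independent B" "card B = CARD('k)" "a > 0"
    and diss: "\<And>w. (\<Sum>b\<in>B. Re (cnj (pairing b w) * pairing (S *v b) w))
                \<le> - a * (\<Sum>b\<in>B. (cmod (pairing b w))\<^sup>2)"
    using stable_triangular_form[of S "CARD('k)"] by blast
  have span: "vec.span B = UNIV"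
    using vec.card_ge_dim_independent[OF subset_UNIV B(2)] B(3) by (auto simp: card_cart_basis)
  define p where "p b z = pairing b (complex_vec z)" for b and z :: "real^'k"
  have p: "p b (x + y) = p b x + p b y" "p b (r *\<^sub>R x) = of_real r * p b x" for b x y and r :: real
    by (simp_all add: p_def pairing_def complex_vec_def algebra_simps sum.distrib sum_distrib_left)
  define ip where "ip x y = (\<Sum>b\<in>B. Re (cnj (p b x) * p b y))" for x y
  have sq: "Re (cnj w * w) = (cmod w)\<^sup>2" for w
    unfolding cmod_power2 by (simp add: power2_eq_square)
  show ?thesis
  proof (rule that)
    have "bilinear ip"
      unfolding bilinear_def
      by (auto intro!: linearI simp: ip_def p algebra_simps sum.distrib sum_distrib_left)
    then show "bounded_bilinear ip"
      by (simp add: bilinear_conv_bounded_bilinear)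
    show "ip x y = ip y x" for x y
      by (simp add: ip_def algebra_simps)
    show "a > 0" by fact
    show "ip x (M *v x) \<le> - a * ip x x" for x
      using diss[of "complex_vec x"]
      by (simp add: ip_def p_def S sq del: times_complex.sel)
    show "ip x x > 0" if "x \<noteq> 0" for x
    proof -
      have "ip x x \<ge> 0" by (simp add: ip_def sq sum_nonneg del: times_complex.sel)
      moreover have "ip x x \<noteq> 0"
      proof
        assume "ip x x = 0"
        then have zero: "pairing b (complex_vec x) = 0" if "b \<in> B" for b
          using that B(1) by (simp add: ip_def p_def sq sum_nonneg_eq_0_iff del: times_complex.sel)
        have "pairing b (complex_vec x) = 0" for b
        proof -
          obtain K where "(cmod (pairing b (complex_vec x)))\<^sup>2
              \<le> K * (\<Sum>b\<in>B. (cmod (pairing b (complex_vec x)))\<^sup>2)"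
            using pairing_span_bound[OF B(1), of b] unfolding span by (metis UNIV_I)
          then show ?thesis by (simp add: zero)
        qed
        \<comment> \<open>The coordinates of x are themselves functionals of this kind.\<close>
        from this[of "axis i 1" for i] have "x = 0"
          by (simp add: pairing_def axis_def if_distribR complex_vec_def vec_eq_iff if_distrib cong: if_cong)
        with that show False by simp
      qed
      ultimately show ?thesis by simp
    qed
  qed
qed

section \<open>Global solutions of Lipschitz fields\<close>

text \<open>Picard iteration on the whole half-line at once. Writing the solution as x0 + exp (2 K
  t) g(t) with g bounded and continuous amounts to a weighted sup norm. In it the integral operator
  contracts: integrating K exp (2 K r) and removing the weight leaves a factor of at most K / (2 K)
  = 1/2.\<close>

lemma lipschitz_global_solution:
  fixes f :: "'a::banach \<Rightarrow> 'a"
  assumes "K > 0" and lip: "\<And>x y. norm (f x - f y) \<le> K * norm (x - y)"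
  shows "\<exists>x. x 0 = x0 \<and> solution_on f {0..} x"
proof -
  have contf: "continuous_on A f" for A
    by (rule continuous_on_subset[OF lipschitz_on_continuous_on[of K UNIV]])
      (use lip \<open>K > 0\<close> in \<open>auto simp: lipschitz_on_def dist_norm\<close>)
  define G where "G g r = f (x0 + exp (2 * K * r) *\<^sub>R apply_bcontfun g r)" for g r
  define J where "J g s = integral {0..s} (G g)" for g :: "real \<Rightarrow>\<^sub>C 'a" and s
  have contG: "continuous_on A (G g)" for A g
    unfolding G_def by (intro continuous_on_compose2[OF contf[of UNIV]] continuous_intros) auto
  have derJ: "(J g has_vector_derivative G g s) (at s within {0..})" if "s \<ge> 0" for g s
  proof -
    have "(J g has_vector_derivative G g s) (at s within {0..s+1})"
      unfolding J_def by (rule integral_has_vector_derivative[OF contG]) (use that in auto)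
    moreover have "at s within {0..} = at s within {0..s+1}"
      by (rule at_within_nhd[of s "{..<s+1}"]) auto
    ultimately show ?thesis by simp
  qed
  then have contJ: "continuous_on {0..} (J g)" for g
    by (auto simp: continuous_on_eq_continuous_within intro: has_vector_derivative_continuous)
  have int_bound: "norm (integral {0..s} H) \<le> C / (2 * K) * exp (2 * K * s)"
    if "s \<ge> 0" "continuous_on {0..s} H" "\<And>r. r \<in> {0..s} \<Longrightarrow> norm (H r) \<le> C * exp (2 * K * r)" for s C and H :: "real \<Rightarrow> 'a"
  proof -
    \<comment> \<open>The bound at r = 0 forces C to be nonnegative, which allows the contribution
      of the lower limit to be dropped.\<close>
    have C: "C \<ge> 0" using that(1) that(3)[of 0] norm_ge_zero[of "H 0"] by (simp del: norm_ge_zero)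
    have "((\<lambda>r. C * exp (2 * K * r)) has_integral
        C / (2 * K) * exp (2 * K * s) - C / (2 * K) * exp (2 * K * 0)) {0..s}"
      by (rule fundamental_theorem_of_calculus[OF \<open>s \<ge> 0\<close>])
        (use \<open>K > 0\<close> in \<open>auto intro!: derivative_eq_intros simp flip: has_real_derivative_iff_has_vector_derivative\<close>)
    then have i: "(\<lambda>r. C * exp (2 * K * r)) integrable_on {0..s}"
      "integral {0..s} (\<lambda>r. C * exp (2 * K * r)) = C / (2 * K) * exp (2 * K * s) - C / (2 * K)"
      by (auto simp: has_integral_iff)
    have "norm (integral {0..s} H) \<le> integral {0..s} (\<lambda>r. C * exp (2 * K * r))"
      by (rule integral_norm_bound_integral) (use that i in \<open>auto intro: integrable_continuous_real\<close>)
    also have "\<dots> \<le> C / (2 * K) * exp (2 * K * s)"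
      using i C \<open>K > 0\<close> by simp
    finally show ?thesis .
  qed
  \<comment> \<open>Elements of the complete space are functions on all of \<open>real\<close>;
    \<open>max t 0\<close> continues the values at negative times by the one at 0.\<close>
  define P where "P g t = exp (- 2 * K * max t 0) *\<^sub>R J g (max t 0)" for g t
  have expm: "exp (- 2 * K * s) * (D / (2 * K) * exp (2 * K * s)) = D / (2 * K)" for s D
    by (simp add: exp_minus)
  have normP: "norm (exp (- 2 * K * s) *\<^sub>R integral {0..s} H) \<le> C / (2 * K)"
    if "s \<ge> 0" "continuous_on {0..s} H" "\<And>r. r \<in> {0..s} \<Longrightarrow> norm (H r) \<le> C * exp (2 * K * r)" for s C and H :: "real \<Rightarrow> 'a"
  proof -
    have "exp (- 2 * K * s) * norm (integral {0..s} H)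
        \<le> exp (- 2 * K * s) * (C / (2 * K) * exp (2 * K * s))"
      by (rule mult_left_mono[OF int_bound[OF that]]) auto
    then show ?thesis unfolding expm by simp
  qed
  have "P g \<in> bcontfun" for g
  proof (rule bcontfun_normI)
    show "continuous_on UNIV (P g)"
      unfolding P_def by (intro continuous_intros continuous_on_compose2[OF contJ]) auto
    show "norm (P g t) \<le> (norm (f x0) + K * norm g) / (2 * K)" for t
      unfolding P_def J_def
    proof (rule normP)
      fix r assume "r \<in> {0..max t 0}"
      then have r: "1 \<le> exp (2 * K * r)" using \<open>K > 0\<close> by simp
      have "norm (G g r) \<le> norm (f x0) + norm (G g r - f x0)"
        using norm_triangle_sub by blast
      also have "norm (G g r - f x0) \<le> K * (exp (2 * K * r) * norm (apply_bcontfun g r))"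
        using lip[of "x0 + exp (2 * K * r) *\<^sub>R apply_bcontfun g r" x0] by (simp add: G_def)
      also have "\<dots> \<le> K * (exp (2 * K * r) * norm g)"
        using \<open>K > 0\<close> by (intro mult_left_mono norm_bounded) auto
      also have "norm (f x0) \<le> norm (f x0) * exp (2 * K * r)"
        using r mult_left_mono[OF r norm_ge_zero[of "f x0"]] by simp
      finally show "norm (G g r) \<le> (norm (f x0) + K * norm g) * exp (2 * K * r)"
        by (simp add: algebra_simps)
    qed (use contG in auto)
  qed
  then have appP: "apply_bcontfun (Bcontfun (P g)) = P g" for g
    by (simp add: Bcontfun_inverse)
  have "dist (Bcontfun (P g)) (Bcontfun (P h)) \<le> 1 / 2 * dist g h" for g h
  proof (rule dist_bound, unfold appP)
    fix t :: real
    define s where "s = max t 0"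
    have "P g t - P h t = exp (- 2 * K * s) *\<^sub>R integral {0..s} (\<lambda>r. G g r - G h r)"
      unfolding P_def J_def s_def
      by (subst Henstock_Kurzweil_Integration.integral_diff)
        (auto intro!: integrable_continuous_real contG simp: scaleR_diff_right)
    also have "norm \<dots> \<le> (K * dist g h) / (2 * K)"
    proof (rule normP)
      fix r assume "r \<in> {0..s}"
      have "norm (G g r - G h r) \<le> K * (exp (2 * K * r) * dist (apply_bcontfun g r) (apply_bcontfun h r))"
        using lip[of "x0 + exp (2 * K * r) *\<^sub>R apply_bcontfun g r" "x0 + exp (2 * K * r) *\<^sub>R apply_bcontfun h r"]
        by (simp add: G_def dist_norm flip: scaleR_diff_right)
      also have "\<dots> \<le> K * (exp (2 * K * r) * dist g h)"
        using \<open>K > 0\<close> by (intro mult_left_mono dist_bounded) auto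
      finally show "norm (G g r - G h r) \<le> (K * dist g h) * exp (2 * K * r)"
        by (simp add: algebra_simps)
    qed (auto simp: s_def intro!: continuous_intros contG)
    finally show "dist (P g t) (P h t) \<le> 1 / 2 * dist g h"
      using \<open>K > 0\<close> by (simp add: dist_norm)
  qed
  then have "\<exists>!g. Bcontfun (P g) = g"
    by (intro banach_fix_type[of "1/2"]) auto
  then obtain g where "Bcontfun (P g) = g" by blast
  then have g: "apply_bcontfun g t = P g t" for t
    using appP[of g] by simp
  \<comment> \<open>The fixed point equation with the weight multiplied back: the curve along which
    \<open>G g\<close> evaluates f is \<open>x0 + J g s\<close> itself.\<close>
  have "x0 + J g s = x0 + exp (2 * K * s) *\<^sub>R apply_bcontfun g s" if "s \<ge> 0" for s
    using that by (simp add: g P_def flip: exp_add)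
  then have "G g s = f (x0 + J g s)" if "s \<ge> 0" for s
    using that by (simp add: G_def)
  then have "solution_on f {0..} (\<lambda>s. x0 + J g s)"
    unfolding solution_on_def by (auto intro!: derivative_eq_intros derJ)
  moreover have "x0 + J g 0 = x0"
    by (simp add: J_def)
  ultimately show ?thesis by (intro exI[of _ "\<lambda>s. x0 + J g s"]) simp
qed

section \<open>Lyapunov's indirect method\<close>

text \<open>Dissipation makes exp (2 \<beta> s) ip (y s) (y s) nonincreasing. The ball condition is
  asked only strictly between 0 and t, so that the estimate reaches up to a first exit time, where
  the norm is only known to be at least r.\<close>

lemma lyapunov_decay:
  fixes y :: "real \<Rightarrow> 'a::real_normed_vector"
  assumes bb: "bounded_bilinear ip" and sym: "\<And>x y. ip x y = ip y x"
    and diss: "\<And>x. norm x \<le> r \<Longrightarrow> ip x (f x) \<le> - \<beta> * ip x x"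
    and sol: "solution_on f {0..t} y" and "t \<ge> 0"
    and inside: "\<And>s. 0 < s \<Longrightarrow> s < t \<Longrightarrow> norm (y s) \<le> r"
  shows "ip (y t) (y t) \<le> exp (- 2 * \<beta> * t) * ip (y 0) (y 0)"
proof -
  interpret bounded_bilinear ip by fact
  have cont: "continuous_on {0..t} y"
    using sol unfolding solution_on_def
    by (auto simp: continuous_on_eq_continuous_within intro: has_vector_derivative_continuous)
  define W where "W s = exp (2 * \<beta> * s) * ip (y s) (y s)" for s
  have "W t \<le> W 0"
  proof (rule DERIV_nonpos_imp_decreasing_open[OF \<open>t \<ge> 0\<close>])
    show "continuous_on {0..t} W"
      unfolding W_def by (intro continuous_intros continuous_on cont)
    fix s assume s: "0 < s" "s < t"
    have "(y has_vector_derivative f (y s)) (at s within {0..t})"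
      using sol s by (auto simp: solution_on_def)
    moreover have "at s within {0..t} = at s"
      using s by (simp add: at_within_Icc_at)
    ultimately have "(y has_vector_derivative f (y s)) (at s)" by simp
    from has_vector_derivative[OF this this]
    have "((\<lambda>s. ip (y s) (y s)) has_real_derivative 2 * ip (y s) (f (y s))) (at s)"
      by (simp add: has_real_derivative_iff_has_vector_derivative sym[of "f (y s)"])
    then have "(W has_real_derivative
        exp (2 * \<beta> * s) * (2 * \<beta> * ip (y s) (y s) + 2 * ip (y s) (f (y s)))) (at s)"
      unfolding W_def by (auto intro!: derivative_eq_intros simp: algebra_simps)
    moreover have "exp (2 * \<beta> * s) * (2 * \<beta> * ip (y s) (y s) + 2 * ip (y s) (f (y s))) \<le> 0"
      using diss[OF inside[OF s]] by (intro mult_nonneg_nonpos) auto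
    ultimately show "\<exists>d. (W has_real_derivative d) (at s) \<and> d \<le> 0" by blast
  qed
  then have "exp (- 2 * \<beta> * t) * (exp (2 * \<beta> * t) * ip (y t) (y t)) \<le> exp (- 2 * \<beta> * t) * ip (y 0) (y 0)"
    by (intro mult_left_mono) (auto simp: W_def)
  then show ?thesis
    by (simp add: mult.assoc[symmetric] flip: exp_add)
qed

lemma solution_on_subset: "solution_on f I y \<Longrightarrow> J \<subseteq> I \<Longrightarrow> solution_on f J y"
  unfolding solution_on_def using has_vector_derivative_within_subset by blast

text \<open>At a first time with norm at least r, decay would keep the form below
  \<open>c * r\<^sup>2\<close>, whereas \<open>low\<close> puts it at or above that value. The
  sublevel set thus lies inside the ball and cannot be left.\<close>

lemma lyapunov_trapping:
  fixes y :: "real \<Rightarrow> 'a::real_normed_vector"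
  assumes bb: "bounded_bilinear ip" and sym: "\<And>x y. ip x y = ip y x"
    and "c > 0" and low: "\<And>x. c * (norm x)\<^sup>2 \<le> ip x x"
    and "\<beta> \<ge> 0" and diss: "\<And>x. norm x \<le> r \<Longrightarrow> ip x (f x) \<le> - \<beta> * ip x x"
    and "r > 0" and start: "ip (y 0) (y 0) < c * r\<^sup>2"
    and sol: "solution_on f {0..t} y" and "t \<ge> 0"
  shows "norm (y t) < r" and "ip (y t) (y t) \<le> exp (- 2 * \<beta> * t) * ip (y 0) (y 0)"
proof -
  have cont: "continuous_on {0..t} y"
    using sol unfolding solution_on_def
    by (auto simp: continuous_on_eq_continuous_within intro: has_vector_derivative_continuous)
  define A where "A = {0..t} \<inter> (\<lambda>s. norm (y s)) -` {r..}"
  have "A = {}"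
  proof (rule ccontr)
    assume "A \<noteq> {}"
    moreover have "closed A"
      unfolding A_def by (intro continuous_closed_preimage continuous_intros cont)
    moreover have "bdd_below A"
      by (auto simp: A_def intro!: bdd_belowI[of _ 0])
    ultimately have first: "Inf A \<in> A" and least: "\<And>s. s \<in> A \<Longrightarrow> Inf A \<le> s"
      by (auto intro: closed_contains_Inf cInf_lower)
    have t1: "0 \<le> Inf A" "Inf A \<le> t" "r \<le> norm (y (Inf A))"
      using first by (auto simp: A_def)
    have before: "norm (y s) \<le> r" if "0 < s" "s < Inf A" for s
    proof (rule ccontr)
      assume "\<not> norm (y s) \<le> r"
      then have "s \<in> A" using that t1 by (auto simp: A_def)
      with least that(2) show False by fastforce
    qed
    have "c * r\<^sup>2 \<le> c * (norm (y (Inf A)))\<^sup>2"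
      using t1 \<open>c > 0\<close> \<open>r > 0\<close> by (intro mult_left_mono power_mono) auto
    also have "\<dots> \<le> ip (y (Inf A)) (y (Inf A))"
      by (rule low)
    also have "\<dots> \<le> exp (- 2 * \<beta> * Inf A) * ip (y 0) (y 0)"
      by (rule lyapunov_decay[where f = f and y = y, OF bb sym diss solution_on_subset[OF sol]]) (use t1 before in auto)
    also have "\<dots> \<le> 1 * ip (y 0) (y 0)"
    proof (rule mult_right_mono)
      have "0 \<le> c * (norm (y 0))\<^sup>2" using \<open>c > 0\<close> by simp
      then show "0 \<le> ip (y 0) (y 0)" using low[of "y 0"] by linarith
    qed (use t1 \<open>\<beta> \<ge> 0\<close> in auto)
    finally show False using start by simp
  qed
  then have inside: "norm (y s) < r" if "0 \<le> s" "s \<le> t" for s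
    using that by (force simp: A_def)
  then show "norm (y t) < r" using \<open>t \<ge> 0\<close> by simp
  show "ip (y t) (y t) \<le> exp (- 2 * \<beta> * t) * ip (y 0) (y 0)"
    by (rule lyapunov_decay[where f = f and y = y, OF bb sym diss sol \<open>t \<ge> 0\<close>]) (use inside in \<open>auto intro: less_imp_le\<close>)
qed

section \<open>From a Lyapunov function to asymptotic stability\<close>

lemma positive_form_bounds:
  fixes ip :: "'a::euclidean_space \<Rightarrow> 'a \<Rightarrow> real"
  assumes bb: "bounded_bilinear ip" and pos: "\<And>x. x \<noteq> 0 \<Longrightarrow> ip x x > 0"
  obtains c C where "c > 0" "C > 0" "\<And>x. c * (norm x)\<^sup>2 \<le> ip x x" "\<And>x y. \<bar>ip x y\<bar> \<le> C * norm x * norm y"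
proof -
  interpret bounded_bilinear ip by fact
  obtain C where C: "C > 0" "\<And>x y. \<bar>ip x y\<bar> \<le> C * norm x * norm y"
    using pos_bounded by (auto simp: mult_ac)
  \<comment> \<open>By homogeneity, the minimum of the quadratic form on the compact unit sphere
    serves as c.\<close>
  have "continuous_on (sphere 0 1) (\<lambda>x. ip x x)"
    by (intro continuous_on continuous_intros)
  moreover have "sphere (0::'a) 1 \<noteq> {}"
    by simp
  ultimately obtain z where z: "z \<in> sphere 0 1" "\<And>x. x \<in> sphere 0 1 \<Longrightarrow> ip z z \<le> ip x x"
    using continuous_attains_inf[OF compact_sphere] by blast
  have "ip z z * (norm x)\<^sup>2 \<le> ip x x" for x
  proof (cases "x = 0")
    case True
    then show ?thesis by (simp add: zero_left)
  next
    case False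
    then have x: "x = norm x *\<^sub>R sgn x" "sgn x \<in> sphere 0 1"
      by (simp_all add: sgn_div_norm)
    have "ip x x = (norm x)\<^sup>2 * ip (sgn x) (sgn x)"
      by (subst x(1), subst (2) x(1)) (simp add: scaleR_left scaleR_right power2_eq_square)
    then show ?thesis
      using mult_right_mono[OF z(2)[OF x(2)], of "(norm x)\<^sup>2"] by (simp add: mult.commute)
  qed
  moreover have "ip z z > 0" using z(1) by (intro pos) auto
  ultimately show ?thesis using that C by blast
qed

text \<open>Trapping at radii \<rho> \<le> r gives stability, and the accompanying exponential decay
  gives attraction. For existence, the projected field agrees with f on the ball and so is
  dissipative there; its global solution is trapped in the ball and therefore solves the original
  equation.\<close>

lemma lyapunov_function_imp_stable:
  fixes f :: "'a::euclidean_space \<Rightarrow> 'a" and ip :: "'a \<Rightarrow> 'a \<Rightarrow> real"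
  assumes "f 0 = 0" and "r > 0"
    and lip: "\<And>x y. norm x \<le> r \<Longrightarrow> norm y \<le> r \<Longrightarrow> norm (f x - f y) \<le> K * norm (x - y)"
    and bb: "bounded_bilinear ip" and sym: "\<And>x y. ip x y = ip y x"
    and pos: "\<And>x. x \<noteq> 0 \<Longrightarrow> ip x x > 0"
    and "\<beta> > 0" and diss: "\<And>x. norm x \<le> r \<Longrightarrow> ip x (f x) \<le> - \<beta> * ip x x"
  shows "locally_asymptotically_stable f 0"
proof -
  obtain c C where c: "c > 0" and C: "C > 0" and low: "\<And>x. c * (norm x)\<^sup>2 \<le> ip x x"
    and up: "\<And>x y. \<bar>ip x y\<bar> \<le> C * norm x * norm y"
    using positive_form_bounds[OF bb pos] by metis
  have \<beta>: "\<beta> \<ge> 0" using \<open>\<beta> > 0\<close> by simp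
  \<comment> \<open>Chosen so that a norm below \<open>\<delta> \<rho>\<close> gives ip x x \<le> C
    |x|^2 < c \<rho>^2, the starting condition of \<open>lyapunov_trapping\<close>.\<close>
  define \<delta> where "\<delta> \<rho> = \<rho> * sqrt (c / C)" for \<rho>
  have \<delta>_pos: "\<delta> \<rho> > 0" if "\<rho> > 0" for \<rho>
    using that c C by (simp add: \<delta>_def)
  have start: "ip x x < c * \<rho>\<^sup>2" if "dist x 0 < \<delta> \<rho>" for x \<rho>
  proof -
    have "(norm x)\<^sup>2 < (\<delta> \<rho>)\<^sup>2"
      using that by (intro power_strict_mono) auto
    then have "C * (norm x)\<^sup>2 < c * \<rho>\<^sup>2"
      using c C by (simp add: \<delta>_def power_mult_distrib field_simps)
    then show ?thesis
      using up[of x x] by (simp add: power2_eq_square mult.assoc)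
  qed
  define \<pi> where "\<pi> = closest_point (cball (0::'a) r)"
  have \<pi>_in: "norm (\<pi> x) \<le> r" for x
    using closest_point_in_set[of "cball (0::'a) r" x] \<open>r > 0\<close> by (auto simp: \<pi>_def)
  have \<pi>_self: "\<pi> x = x" if "norm x \<le> r" for x
    using that by (simp add: \<pi>_def closest_point_self)
  have ex: "\<exists>x. x 0 = x0 \<and> solution_on f {0..} x" if x0: "dist x0 0 < \<delta> r" for x0
  proof -
    \<comment> \<open>K comes without a sign condition, while
      \<open>lipschitz_global_solution\<close> asks for a positive constant; hence
      \<open>\<bar>K\<bar> + 1\<close>.\<close>
    have "norm (f (\<pi> x) - f (\<pi> y)) \<le> (\<bar>K\<bar> + 1) * norm (x - y)" for x y
    proof -
      have "norm (f (\<pi> x) - f (\<pi> y)) \<le> K * norm (\<pi> x - \<pi> y)"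
        by (rule lip[OF \<pi>_in \<pi>_in])
      also have "\<dots> \<le> (\<bar>K\<bar> + 1) * norm (\<pi> x - \<pi> y)"
        by (intro mult_right_mono) auto
      also have "\<dots> \<le> (\<bar>K\<bar> + 1) * norm (x - y)"
        using closest_point_lipschitz[of "cball (0::'a) r" x y] \<open>r > 0\<close>
        by (intro mult_left_mono) (auto simp: \<pi>_def dist_norm)
      finally show ?thesis .
    qed
    then obtain x where x: "x 0 = x0" "solution_on (\<lambda>x. f (\<pi> x)) {0..} x"
      using lipschitz_global_solution[of "\<bar>K\<bar> + 1" "\<lambda>x. f (\<pi> x)" x0] by fastforce
    have "norm (x t) < r" if "t \<ge> 0" for t
    proof (rule lyapunov_trapping(1)[where f = "\<lambda>x. f (\<pi> x)" and y = x, OF bb sym c low \<beta> _ \<open>r > 0\<close> _ _ that])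
      show "solution_on (\<lambda>x. f (\<pi> x)) {0..t} x"
        by (rule solution_on_subset[OF x(2)]) auto
      show "ip (x 0) (x 0) < c * r\<^sup>2"
        using start[OF x0] x(1) by simp
      show "ip y (f (\<pi> y)) \<le> - \<beta> * ip y y" if "norm y \<le> r" for y
        using diss[OF that] \<pi>_self[OF that] by simp
    qed
    then have "solution_on f {0..} x"
      using x(2) \<pi>_self by (auto simp: solution_on_def less_imp_le)
    with x(1) show ?thesis by blast
  qed
  have stab: "norm (x t) < \<rho>"
    if \<rho>: "0 < \<rho>" "\<rho> \<le> r" and sol: "solution_on f {0..<T} x" and x0: "dist (x 0) 0 < \<delta> \<rho>"
      and t: "t \<in> {0..<T}" for x T \<rho> t
  proof -
    have "ip x (f x) \<le> - \<beta> * ip x x" if "norm x \<le> \<rho>" for x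
      using diss that \<rho>(2) by simp
    moreover have "solution_on f {0..t} x"
      by (rule solution_on_subset[OF sol]) (use t in auto)
    ultimately show ?thesis
      using lyapunov_trapping(1)[where f = f and y = x, OF bb sym c low \<beta> _ \<rho>(1) start[OF x0]] t
      by (metis atLeastLessThan_iff)
  qed
  have attr: "(x \<longlongrightarrow> 0) at_top" if sol: "solution_on f {0..} x" and x0: "dist (x 0) 0 < \<delta> r" for x
  proof -
    have decay: "(norm (x t))\<^sup>2 \<le> exp (- (2 * \<beta>) * t) * (ip (x 0) (x 0) / c)" if "t \<ge> 0" for t
    proof -
      have "solution_on f {0..t} x"
        by (rule solution_on_subset[OF sol]) auto
      from lyapunov_trapping(2)[where f = f and y = x, OF bb sym c low \<beta> diss \<open>r > 0\<close> start[OF x0] this that]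
      show ?thesis
        using low[of "x t"] c by (simp add: field_simps)
    qed
    have "((\<lambda>t. exp (- (2 * \<beta>) * t) * (ip (x 0) (x 0) / c)) \<longlongrightarrow> 0) at_top"
    proof (rule tendsto_mult_left_zero, rule filterlim_compose[OF exp_at_bot])
      show "LIM t at_top. - (2 * \<beta>) * t :> at_bot"
        by (rule filterlim_tendsto_neg_mult_at_bot[OF tendsto_const _ filterlim_ident]) (use \<open>\<beta> > 0\<close> in simp)
    qed
    moreover have "\<forall>\<^sub>F t in at_top. (norm (x t))\<^sup>2 \<le> exp (- (2 * \<beta>) * t) * (ip (x 0) (x 0) / c)"
      using eventually_ge_at_top[of 0] by eventually_elim (rule decay)
    ultimately have "((\<lambda>t. (norm (x t))\<^sup>2) \<longlongrightarrow> 0) at_top"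
      using tendsto_sandwich[of "\<lambda>_. 0" "\<lambda>t. (norm (x t))\<^sup>2" at_top] by simp
    from tendsto_real_sqrt[OF this] show ?thesis
      by (simp add: tendsto_norm_zero_iff)
  qed
  show ?thesis
    unfolding locally_asymptotically_stable_def
  proof (intro conjI allI impI)
    show "\<exists>\<delta>>0. \<forall>x T. solution_on f {0..<T} x \<and> dist (x 0) 0 < \<delta>
        \<longrightarrow> (\<forall>t\<in>{0..<T}. dist (x t) 0 < \<epsilon>)" if "\<epsilon> > 0" for \<epsilon>
    \<comment> \<open>Dissipation is available up to radius r only, hence the minimum.\<close>
    proof (intro exI[of _ "\<delta> (min r \<epsilon>)"] conjI allI impI ballI)
      show "\<delta> (min r \<epsilon>) > 0" using that \<open>r > 0\<close> \<delta>_pos by simp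
      fix x T t assume "solution_on f {0..<T} x \<and> dist (x 0) 0 < \<delta> (min r \<epsilon>)" "t \<in> {0..<T}"
      then have "norm (x t) < min r \<epsilon>"
        using stab[of "min r \<epsilon>"] that \<open>r > 0\<close> by auto
      then show "dist (x t) 0 < \<epsilon>" by simp
    qed
    show "\<exists>\<delta>>0. \<forall>x0. dist x0 0 < \<delta> \<longrightarrow> (\<exists>x. x 0 = x0 \<and> solution_on f {0..} x)"
      using ex \<delta>_pos[OF \<open>r > 0\<close>] by (intro exI[of _ "\<delta> r"]) blast
    show "\<exists>\<delta>>0. \<forall>x. solution_on f {0..} x \<and> dist (x 0) 0 < \<delta> \<longrightarrow> (x \<longlongrightarrow> 0) at_top"
      using attr \<delta>_pos[OF \<open>r > 0\<close>] by (intro exI[of _ "\<delta> r"]) blast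
  qed fact
qed

section \<open>The remainder after linearisation and Lyapunov's criterion\<close>

lemma norm_matrix_vector_le:
  fixes A :: "real^'n^'m"
  shows "norm (A *v x) \<le> real CARD('m) * real CARD('n) * norm A * norm x"
proof -
  have "\<bar>A $ i $ j\<bar> \<le> norm A" for i j
    using component_le_norm_cart[of "A $ i" j] Finite_Cartesian_Product.norm_nth_le[of A i] by simp
  then have "onorm ((*v) A) \<le> real CARD('m) * real CARD('n) * norm A"
    by (rule onorm_le_matrix_component)
  then have "onorm ((*v) A) * norm x \<le> real CARD('m) * real CARD('n) * norm A * norm x"
    by (rule mult_right_mono) simp
  with onorm[OF matrix_vector_mul_bounded_linear, of A x] show ?thesis
    by linarith
qed

text \<open>Mean value inequality for f minus its linear part: the derivative
  \<open>J z - J 0\<close> is small near 0 by continuity. Continuity controls an open ball of radius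
  d; the half radius gives a closed convex ball inside it.\<close>

lemma C1_lipschitz_remainder:
  fixes f :: "real^'k \<Rightarrow> real^'k" and J :: "real^'k \<Rightarrow> real^'k^'k"
  assumes deriv: "\<And>z. (f has_derivative (\<lambda>h. J z *v h)) (at z)" and cont: "isCont J 0"
    and "e > 0"
  obtains r where "r > 0"
    "\<And>x y. norm x \<le> r \<Longrightarrow> norm y \<le> r \<Longrightarrow> norm (f x - f y - J 0 *v (x - y)) \<le> e * norm (x - y)"
proof -
  \<comment> \<open>The factor from \<open>norm_matrix_vector_le\<close>; continuity of J is invoked
    with e / n to compensate for it.\<close>
  define n where "n = real CARD('k) * real CARD('k)"
  have n: "n > 0" by (simp add: n_def)
  obtain d where d: "d > 0" "\<And>z. norm z < d \<Longrightarrow> norm (J z - J 0) < e / n"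
    using cont \<open>e > 0\<close> n unfolding continuous_at_eps_delta dist_norm
    by (auto dest: spec[of _ "e / n"])
  have bound: "norm ((f x - J 0 *v x) - (f y - J 0 *v y)) \<le> e * norm (x - y)"
    if "norm x \<le> d / 2" "norm y \<le> d / 2" for x y
  proof (rule differentiable_bound[of "cball 0 (d / 2)"])
    fix z :: "real^'k" assume "z \<in> cball 0 (d / 2)"
    then have z: "norm z < d" using d(1) by simp
    show "((\<lambda>z. f z - J 0 *v z) has_derivative (\<lambda>h. (J z - J 0) *v h)) (at z within cball 0 (d / 2))"
      unfolding matrix_vector_mult_diff_rdistrib
      by (intro has_derivative_diff has_derivative_at_withinI[OF deriv]
          bounded_linear_imp_has_derivative matrix_vector_mul_bounded_linear)
    show "onorm (\<lambda>h. (J z - J 0) *v h) \<le> e"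
    proof (rule onorm_le)
      fix h :: "real^'k"
      have "norm ((J z - J 0) *v h) \<le> n * norm (J z - J 0) * norm h"
        unfolding n_def by (rule norm_matrix_vector_le)
      also have "\<dots> \<le> e * norm h"
        using d(2)[OF z] n by (intro mult_right_mono) (auto simp: field_simps)
      finally show "norm ((J z - J 0) *v h) \<le> e * norm h" .
    qed
  qed (use that in auto)
  show ?thesis
  proof (rule that[of "d / 2"])
    show "norm (f x - f y - J 0 *v (x - y)) \<le> e * norm (x - y)"
      if "norm x \<le> d / 2" "norm y \<le> d / 2" for x y
      using bound[OF that] by (simp add: matrix_vector_mult_diff_distrib algebra_simps)
  qed (use d in simp)
qed

lemma linearised_stability:
  fixes f :: "real^'k \<Rightarrow> real^'k" and J :: "real^'k \<Rightarrow> real^'k^'k"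
  assumes "f 0 = 0" and deriv: "\<And>z. (f has_derivative (\<lambda>h. J z *v h)) (at z)"
    and cont: "isCont J 0" and hurwitz: "spec (J 0) \<subseteq> left_half_plane"
  shows "locally_asymptotically_stable f 0"
proof -
  obtain ip :: "real^'k \<Rightarrow> real^'k \<Rightarrow> real" and a where
    bb: "bounded_bilinear ip" and sym: "\<And>x y. ip x y = ip y x" and pos: "\<And>x. x \<noteq> 0 \<Longrightarrow> ip x x > 0"
    and a: "a > 0" "\<And>x. ip x (J 0 *v x) \<le> - a * ip x x"
    using hurwitz_inner_product[OF hurwitz] by metis
  interpret ip: bounded_bilinear ip by fact
  obtain c C where c: "c > 0" and C: "C > 0" and low: "\<And>x. c * (norm x)\<^sup>2 \<le> ip x x"
    and up: "\<And>x y. \<bar>ip x y\<bar> \<le> C * norm x * norm y"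
    using positive_form_bounds[OF bb pos] by metis
  \<comment> \<open>With this e the remainder contributes at most C |x| e |x| = (a / 2) c |x|^2,
    which is at most half of the linear dissipation; the rate a / 2 survives.\<close>
  define e where "e = a * c / (2 * C)"
  have e: "e > 0" using a(1) c C by (simp add: e_def)
  obtain r where r: "r > 0"
    "\<And>x y. norm x \<le> r \<Longrightarrow> norm y \<le> r \<Longrightarrow> norm (f x - f y - J 0 *v (x - y)) \<le> e * norm (x - y)"
    using C1_lipschitz_remainder[OF deriv cont e] by metis
  show ?thesis
  proof (rule lyapunov_function_imp_stable[where f = f and \<beta> = "a / 2", OF \<open>f 0 = 0\<close> r(1) _ bb sym pos])
    show "a / 2 > 0" using a(1) by simp
    fix x :: "real^'k" assume x: "norm x \<le> r"
    have "norm (f x - J 0 *v x) \<le> e * norm x"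
      using r(2)[OF x, of 0] r(1) \<open>f 0 = 0\<close> by simp
    then have "C * norm x * norm (f x - J 0 *v x) \<le> C * norm x * (e * norm x)"
      using C by (intro mult_left_mono) auto
    also have "\<dots> = a / 2 * (c * (norm x)\<^sup>2)"
      using C by (simp add: e_def power2_eq_square)
    also have "\<dots> \<le> a / 2 * ip x x"
      using a(1) low by (intro mult_left_mono) auto
    finally have "ip x (f x - J 0 *v x) \<le> a / 2 * ip x x"
      using up[of x "f x - J 0 *v x"] by linarith
    moreover have "ip x (f x) = ip x (J 0 *v x) + ip x (f x - J 0 *v x)"
      by (simp flip: ip.add_right)
    ultimately show "ip x (f x) \<le> - (a / 2) * ip x x"
      using a(2)[of x] by simp
    fix y :: "real^'k" assume y: "norm y \<le> r"
    have "norm (f x - f y) \<le> norm (f x - f y - J 0 *v (x - y)) + norm (J 0 *v (x - y))"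
      by (metis diff_add_cancel norm_triangle_ineq)
    also have "\<dots> \<le> e * norm (x - y) + onorm ((*v) (J 0)) * norm (x - y)"
      by (intro add_mono r(2) x y onorm matrix_vector_mul_bounded_linear)
    finally show "norm (f x - f y) \<le> (e + onorm ((*v) (J 0))) * norm (x - y)"
      by (simp add: distrib_right)
  qed
qed

section \<open>The Jacobian of the closed loop\<close>

text \<open>\<open>deviation\<close> extends h by zero at the missing coordinate (g, 1). Restoring
  the deleted column in this way adds nothing to the product, which can then be computed with full
  blocks and without a case distinction for the reference node.\<close>

lemma state_blocks_mult:
  fixes c :: "'s::finite \<Rightarrow> 'n::finite \<times> 3"
  assumes "coordinates g c"
  shows "(state_blocks c M *v h) $ s
    = (\<Sum>j\<in>UNIV. (M (fst (c s)) j *v (\<chi> b. deviation g c h j b)) $ snd (c s))"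
proof -
  let ?m = "\<lambda>p. M (fst (c s)) (fst p) $ snd (c s) $ snd p * deviation g c h (fst p) (snd p)"
  have bij: "bij_betw c UNIV (UNIV - {(g, 1)})"
    using assms by (simp add: coordinates_def)
  then have "c t \<noteq> (g, 1)" "inv c (c t) = t" for t
    by (auto simp: bij_betw_def)
  then have "(state_blocks c M *v h) $ s = (\<Sum>t\<in>UNIV. ?m (c t))"
    by (simp add: matrix_vector_mult_def state_blocks_def deviation_def)
  also have "\<dots> = (\<Sum>p\<in>UNIV - {(g, 1)}. ?m p)"
    by (rule sum.reindex_bij_betw[OF bij])
  also have "\<dots> = (\<Sum>p\<in>UNIV. ?m p)"
    by (rule sum.mono_neutral_left) (auto simp: deviation_def)
  also have "\<dots> = (\<Sum>j\<in>UNIV. \<Sum>b\<in>UNIV. ?m (j, b))"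
    by (simp add: sum.cartesian_product case_prod_beta)
  finally show ?thesis
    by (simp add: matrix_vector_mult_def)
qed

lemma sum_block_diag_mult:
  fixes D :: "'n::finite \<Rightarrow> real^'a^'b"
  shows "(\<Sum>j\<in>UNIV. (block_diag D i j *v w j) $ a) = (D i *v w i) $ a"
proof -
  have "(\<Sum>j\<in>UNIV. (block_diag D i j *v w j) $ a) = (\<Sum>j\<in>UNIV. if i = j then (D j *v w j) $ a else 0)"
    by (rule sum.cong) (auto simp: block_diag_def)
  then show ?thesis by simp
qed

text \<open>Inputs enter the node equations additively with constant coefficients. A linear feedback
  G therefore adds exactly the constant matrix B G to the Jacobian of the uncontrolled
  field.\<close>

lemma controlled_field_affine:
  "controlled_field N g c xs z u = controlled_field N g c xs z 0 + B_full N c *v u"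
proof (rule vec_eq_iff[THEN iffD2, rule_format])
  fix s
  obtain i a where ia: "c s = (i, a)" by fastforce
  have "(B_full N c *v u) $ s = (\<Sum>j\<in>UNIV. \<Sum>k\<in>UNIV. block_diag (B_node N) i j $ a $ k * u $ (j, k))"
    by (simp add: matrix_vector_mult_def B_full_def ia sum.cartesian_product case_prod_beta)
  also have "\<dots> = (\<Sum>j\<in>UNIV. (block_diag (B_node N) i j *v (\<chi> k. u $ (j, k))) $ a)"
    by (simp add: matrix_vector_mult_def)
  also have "\<dots> = (B_node N i *v (\<chi> k. u $ (i, k))) $ a"
    by (rule sum_block_diag_mult)
  finally show "controlled_field N g c xs z u $ s
      = (controlled_field N g c xs z 0 + B_full N c *v u) $ s"
    using exhaust_3[of a]
    by (auto simp: controlled_field_def ia node_rhs_def B_node_def matrix_vector_mult_def sum_2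
        add_divide_distrib diff_divide_distrib)
qed

lemma state_at_0: "state_at g c xs 0 = xs"
  by (simp add: state_at_def deviation_def cong: if_cong)

text \<open>The field sums over all nodes, the synchronous state over neighbours; the terms in
  between vanish with the coefficients. \<open>neighbours\<close> reads an edge as (j, i) and the
  coefficients as (i, j), hence the symmetry hypothesis.\<close>

lemma controlled_field_equilibrium:
  assumes sync: "synchronous_state N xs" and lossless: "connected_lossless N"
    and sym: "sym (edges N)"
  shows "controlled_field N g c xs 0 0 = 0"
proof (rule vec_eq_iff[THEN iffD2, rule_format])
  fix s
  obtain i a where ia: "c s = (i, a)" by fastforce
  have zero: "susc N i j = 0" "cond N i j = 0" if "j \<notin> neighbours N i" for j
  proof -
    have "(i, j) \<notin> edges N"
      using that symD[OF sym] by (auto simp: neighbours_def)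
    then show "susc N i j = 0" "cond N i j = 0"
      using lossless by (auto simp: connected_lossless_def)
  qed
  have "(\<Sum>j\<in>UNIV. active_power N xs i j) = (\<Sum>j\<in>neighbours N i. active_power N xs i j)"
    by (rule sum.mono_neutral_right) (auto simp: active_power_def zero)
  moreover have "(\<Sum>j\<in>UNIV. reactive_power N xs i j) = (\<Sum>j\<in>neighbours N i. reactive_power N xs i j)"
    by (rule sum.mono_neutral_right) (auto simp: reactive_power_def zero)
  ultimately show "controlled_field N g c xs 0 0 $ s = 0 $ s"
    using sync exhaust_3[of a]
    by (auto simp: controlled_field_def ia node_rhs_def state_at_0 synchronous_state_def)
qed

text \<open>The right-hand side is the node equation differentiated in direction h, arranged like
  \<open>node_rhs\<close> with sums over all nodes. \<open>Ax_node\<close> supplies the power-flow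
  terms in w i, \<open>Ahat_block\<close> those in w j. The state x is arbitrary because the matrix
  has to be recognised as the Jacobian at every state, not only at the equilibrium.\<close>

lemma A_tilde_mult:
  fixes c :: "'s::finite \<Rightarrow> 'n::finite \<times> 3"
    and h :: "real^'s"
  assumes coords: "coordinates g c" and lossless: "connected_lossless N"
    and sym: "sym (edges N)" and s: "c s = (i, a)"
  defines "w \<equiv> deviation g c h"
  shows "(A_tilde N c x *v h) $ s = (vector :: real list \<Rightarrow> real^3) [w i 2,
    (- damping N i * w i 2 - (\<Sum>j\<in>UNIV.
        susc N i j * (volt x j * sin (angle_diff x i j) * w i 3 + volt x i * sin (angle_diff x i j) * w j 3
          + volt x i * volt x j * cos (angle_diff x i j) * (w i 1 - w j 1)))) / inertia N i,
    (- vdecay N i * w i 3 - (\<Sum>j\<in>UNIV.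
        susc N i j * (- volt x j * cos (angle_diff x i j) * w i 3 - volt x i * cos (angle_diff x i j) * w j 3
          + volt x i * volt x j * sin (angle_diff x i j) * (w i 1 - w j 1)))) / tconst N i] $ a"
proof -
  let ?w = "\<lambda>j. \<chi> b. w j b"
  have zero: "susc N i j = 0" if "(i, j) \<notin> edges N \<or> (j, i) \<notin> edges N" for j
  proof -
    have "(i, j) \<notin> edges N"
      using that symD[OF sym] by blast
    then show ?thesis
      using lossless by (auto simp: connected_lossless_def)
  qed
  \<comment> \<open>D and H are the summands without the edge condition; the factor
    \<open>susc N i j\<close> makes them vanish off the edges.\<close>
  define D where "D j = (vector [
    vector [0, 0, 0],
    vector [- (susc N i j * volt x i * volt x j * cos (angle_diff x i j) / inertia N i), 0,
            - (susc N i j * volt x j * sin (angle_diff x i j) / inertia N i)],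
    vector [- (susc N i j * volt x i * volt x j * sin (angle_diff x i j) / tconst N i), 0,
            susc N i j * volt x j * cos (angle_diff x i j) / tconst N i]] :: real^3^3)" for j
  define H where "H j = (vector [
    vector [0, 0, 0],
    vector [susc N i j * volt x i * volt x j * cos (angle_diff x i j) / inertia N i, 0,
            - (susc N i j * volt x i * sin (angle_diff x i j) / inertia N i)],
    vector [susc N i j * volt x i * volt x j * sin (angle_diff x i j) / tconst N i, 0,
            susc N i j * volt x i * cos (angle_diff x i j) / tconst N i]] :: real^3^3)" for j
  have mv3: "(vector [r1, r2, r3] *v y) $ b = vector [r1 \<bullet> y, r2 \<bullet> y, r3 \<bullet> y] $ b"
    for r1 r2 r3 :: "real^3" and y and b :: 3
    using exhaust_3[of b] by (auto simp: matrix_vector_mult_def inner_vec_def)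
  have v0: "vector [0, 0, 0] = (0 :: real^3)"
    by (simp add: vec_eq_iff forall_3)
  have "Ax_node N x i = (\<Sum>j\<in>neighbours N i. D j)"
    by (simp add: Ax_node_def D_def)
  also have "\<dots> = (\<Sum>j\<in>UNIV. D j)"
  proof (rule sum.mono_neutral_left)
    show "\<forall>j\<in>UNIV - neighbours N i. D j = 0"
      by (auto simp: D_def zero neighbours_def vec_eq_iff forall_3)
  qed auto
  finally have Ax: "(Ax_node N x i *v y) $ a = (\<Sum>j\<in>UNIV. (D j *v y) $ a)" for y
    by (simp add: matrix_vector_mult_def sum_distrib_right) (rule sum.swap)
  have H: "Ahat_block N x i j = H j" for j
    by (auto simp: Ahat_block_def H_def zero vec_eq_iff forall_3)
  have "(A_tilde N c x *v h) $ s = (A_node N i *v ?w i) $ a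
      + (\<Sum>j\<in>UNIV. (D j *v ?w i) $ a + (H j *v ?w j) $ a)"
    unfolding A_tilde_def matrix_vector_mult_add_rdistrib vector_add_component
      state_blocks_mult[OF coords] s fst_conv snd_conv sum_block_diag_mult w_def[symmetric] Ax H
    by (simp add: sum.distrib)
  moreover have "(A_node N i *v ?w i) $ a = (vector :: real list \<Rightarrow> real^3)
      [w i 2, - damping N i * w i 2 / inertia N i, - vdecay N i * w i 3 / tconst N i] $ a"
    using exhaust_3[of a] by (auto simp: A_node_def mv3 inner_vec_def sum_3)
  moreover have "(D j *v ?w i) $ a + (H j *v ?w j) $ a = (vector :: real list \<Rightarrow> real^3) [0,
      - (susc N i j * (volt x j * sin (angle_diff x i j) * w i 3 + volt x i * sin (angle_diff x i j) * w j 3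
          + volt x i * volt x j * cos (angle_diff x i j) * (w i 1 - w j 1)) / inertia N i),
      - (susc N i j * (- volt x j * cos (angle_diff x i j) * w i 3 - volt x i * cos (angle_diff x i j) * w j 3
          + volt x i * volt x j * sin (angle_diff x i j) * (w i 1 - w j 1)) / tconst N i)] $ a" for j
    using exhaust_3[of a]
    by (auto simp: D_def H_def mv3 inner_vec_def sum_3 algebra_simps add_divide_distrib diff_divide_distrib)
  ultimately show ?thesis
    using exhaust_3[of a]
    by (auto simp: sum_negf sum_divide_distrib diff_divide_distrib)
qed

section \<open>Derivative of the closed-loop field and continuity of its Jacobian\<close>

lemma has_derivative_vec_nth:
  fixes f :: "'a::real_normed_vector \<Rightarrow> real^'s"
  assumes "\<And>s. ((\<lambda>z. f z $ s) has_derivative (\<lambda>h. f' h $ s)) (at a within S)"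
  shows "(f has_derivative f') (at a within S)"
proof (subst has_derivative_componentwise_within, rule ballI)
  fix b :: "real^'s" assume "b \<in> Basis"
  then obtain s where "b = axis s 1"
    by (auto simp: Basis_vec_def)
  then show "((\<lambda>z. f z \<bullet> b) has_derivative (\<lambda>h. f' h \<bullet> b)) (at a within S)"
    using assms[of s] by (simp add: inner_axis)
qed

lemma bounded_linear_deviation: "bounded_linear (\<lambda>z. deviation g c z i a)"
  unfolding deviation_def by (cases "(i, a) = (g, 1)") (simp_all add: bounded_linear_vec_nth del: prod.inject)

lemma controlled_field_has_derivative:
  fixes c :: "'s::finite \<Rightarrow> 'n::finite \<times> 3"
  assumes coords: "coordinates g c" and lossless: "connected_lossless N"
    and sym: "sym (edges N)"
  shows "((\<lambda>z. controlled_field N g c xs z (G *v z)) has_derivative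
    (\<lambda>h. (A_tilde N c (state_at g c xs z) + B_full N c ** G) *v h)) (at z)"
proof -
  have cond: "cond N i j = 0" for i j
    using lossless by (simp add: connected_lossless_def)
  have dev: "((\<lambda>z. deviation g c z i a) has_derivative (\<lambda>h. deviation g c h i a)) (at z)" for i a
    by (rule bounded_linear_imp_has_derivative[OF bounded_linear_deviation])
  let ?x = "state_at g c xs z"
  \<comment> \<open>The differentials of the power flows, written exactly like the summands in
    \<open>A_tilde_mult\<close>, so that the comparison ends by rewriting.\<close>
  let ?dP = "\<lambda>i j h. susc N i j * (volt ?x j * sin (angle_diff ?x i j) * deviation g c h i 3
      + volt ?x i * sin (angle_diff ?x i j) * deviation g c h j 3
      + volt ?x i * volt ?x j * cos (angle_diff ?x i j) * (deviation g c h i 1 - deviation g c h j 1))"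
  let ?dQ = "\<lambda>i j h. susc N i j * (- volt ?x j * cos (angle_diff ?x i j) * deviation g c h i 3
      - volt ?x i * cos (angle_diff ?x i j) * deviation g c h j 3
      + volt ?x i * volt ?x j * sin (angle_diff ?x i j) * (deviation g c h i 1 - deviation g c h j 1))"
  have P: "((\<lambda>z. active_power N (state_at g c xs z) i j) has_derivative ?dP i j) (at z)" for i j
    unfolding active_power_def angle_diff_def state_at_def cond
    by (auto intro!: derivative_eq_intros dev simp: algebra_simps)
  have Q: "((\<lambda>z. reactive_power N (state_at g c xs z) i j) has_derivative ?dQ i j) (at z)" for i j
    unfolding reactive_power_def angle_diff_def state_at_def cond
    by (auto intro!: derivative_eq_intros dev simp: algebra_simps)
  have \<omega>: "((\<lambda>z. freq (state_at g c xs z) i) has_derivative (\<lambda>h. deviation g c h i 2)) (at z)" for i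
    unfolding state_at_def by (auto intro!: derivative_eq_intros dev)
  have v: "((\<lambda>z. volt (state_at g c xs z) i) has_derivative (\<lambda>h. deviation g c h i 3)) (at z)" for i
    unfolding state_at_def by (auto intro!: derivative_eq_intros dev)
  have "((\<lambda>z. controlled_field N g c xs z 0) has_derivative (\<lambda>h. A_tilde N c ?x *v h)) (at z)"
  proof (rule has_derivative_vec_nth)
    fix s
    obtain i a where ia: "c s = (i, a)" by fastforce
    consider "a = 1" | "a = 2" | "a = 3"
      using exhaust_3[of a] by blast
    then show "((\<lambda>z. controlled_field N g c xs z 0 $ s) has_derivative (\<lambda>h. (A_tilde N c ?x *v h) $ s)) (at z)"
    proof cases
      case 1
      then show ?thesis
        unfolding A_tilde_mult[OF coords lossless sym ia] controlled_field_def node_rhs_def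
        by (simp add: ia \<omega>)
    next
      case 2
      \<comment> \<open>The \<open>0\<close> added in the function is the absent input, kept to
        match \<open>node_rhs\<close>; the zeros in the derivative come from
        \<open>pconst N i\<close> and from that input.\<close>
      have "((\<lambda>z. (- damping N i * freq (state_at g c xs z) i + pconst N i
            - (\<Sum>j\<in>UNIV. active_power N (state_at g c xs z) i j) + 0) / inertia N i) has_derivative
          (\<lambda>h. (- damping N i * deviation g c h i 2 + 0 - (\<Sum>j\<in>UNIV. ?dP i j h) + 0) / inertia N i)) (at z)"
        by (intro bounded_linear.has_derivative[OF bounded_linear_divide] has_derivative_add has_derivative_diff has_derivative_sum
            has_derivative_mult_right has_derivative_const P \<omega>)
      with 2 show ?thesis
        unfolding A_tilde_mult[OF coords lossless sym ia] controlled_field_def node_rhs_def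
        by (simp add: ia)
    next
      case 3
      have "((\<lambda>z. (- vdecay N i * volt (state_at g c xs z) i + qconst N i
            - (\<Sum>j\<in>UNIV. reactive_power N (state_at g c xs z) i j) + 0) / tconst N i) has_derivative
          (\<lambda>h. (- vdecay N i * deviation g c h i 3 + 0 - (\<Sum>j\<in>UNIV. ?dQ i j h) + 0) / tconst N i)) (at z)"
        by (intro bounded_linear.has_derivative[OF bounded_linear_divide] has_derivative_add has_derivative_diff has_derivative_sum
            has_derivative_mult_right has_derivative_const Q v)
      with 3 show ?thesis
        unfolding A_tilde_mult[OF coords lossless sym ia] controlled_field_def node_rhs_def
        by (simp add: ia)
    qed
  qed
  moreover have "((\<lambda>z. B_full N c *v (G *v z)) has_derivative (\<lambda>h. B_full N c *v (G *v h))) (at z)"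
    by (intro bounded_linear_imp_has_derivative bounded_linear_compose[OF matrix_vector_mul_bounded_linear]
        matrix_vector_mul_bounded_linear)
  ultimately show ?thesis
    unfolding controlled_field_affine[of N g c xs _ "G *v _"]
    by (simp add: matrix_vector_mult_add_rdistrib matrix_vector_mul_assoc[symmetric] has_derivative_add)
qed

lemma isCont_vector_3:
  fixes p q r :: "'a::t2_space \<Rightarrow> 'b::{zero,topological_space}"
  assumes "isCont p z" "isCont q z" "isCont r z"
  shows "isCont (\<lambda>z. vector [p z, q z, r z] :: 'b^3) z"
  unfolding isCont_def
proof (rule vec_tendstoI)
  show "((\<lambda>z. (vector [p z, q z, r z] :: 'b^3) $ i) \<longlongrightarrow> (vector [p z, q z, r z] :: 'b^3) $ i) (at z)" for i :: 3
    using assms exhaust_3[of i] by (auto simp: isCont_def)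
qed

lemma continuous_A_tilde:
  "isCont (\<lambda>z. A_tilde N c (state_at g c xs z)) z"
proof -
  have dev: "isCont (\<lambda>z. deviation g c z i a) z" for i a
    by (rule linear_continuous_at[OF bounded_linear_deviation])

  have "isCont (\<lambda>z. Ax_node N (state_at g c xs z) i) z" for i
    \<comment> \<open>\<open>divide_inverse\<close> turns division by the constants
      \<open>inertia N i\<close> and \<open>tconst N i\<close> into multiplication by
      constants.\<close>
    unfolding Ax_node_def divide_inverse state_at_def angle_diff_def
    by (auto intro!: continuous_intros isCont_vector_3 dev)
  moreover have "isCont (\<lambda>z. Ahat_block N (state_at g c xs z) i j) z" for i j
    unfolding Ahat_block_def divide_inverse state_at_def angle_diff_def
    by (cases "(i, j) \<in> edges N") (auto intro!: continuous_intros isCont_vector_3 dev)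
  ultimately show ?thesis
    unfolding A_tilde_def state_blocks_def block_diag_def isCont_def
    by (auto intro!: tendsto_intros)
qed

theorem mainTheorem3:
  fixes L5 L4 L3 :: "'n::finite set"
    and N :: "'n network"
    and xs :: "'n pstate"
    and g :: 'n
    and c :: "'s::finite \<Rightarrow> 'n \<times> 3"
    and Quu :: "'n \<Rightarrow> real^2^2"
    and Ct Cv :: "'n \<Rightarrow> real"
    and Cg Qg :: "real^2^2"
    and Q :: "'n \<Rightarrow> real^3^3"
  assumes tree: "hierarchical_tree L5 L4 L3 (edges N)"
    and sync: "synchronous_state N xs"
    and ref: "g \<in> L3"
    and coords: "coordinates g c"
    and lossless: "connected_lossless N"
    and angles: "\<forall>(i, j)\<in>edges N. \<bar>angle xs i - angle xs j\<bar> < pi / 2"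
    and params: "positive_parameters L5 L4 L3 N xs"
    and design: "distributed_design N g Quu Ct Cv Cg Q Qg"
    and hurwitz: "spec (A_tilde N c xs + B_full N c ** F_full N g c Quu Q Qg) \<subseteq> left_half_plane"
  shows "locally_asymptotically_stable
           (\<lambda>z. controlled_field N g c xs z (F_full N g c Quu Q Qg *v z)) 0"
proof (rule linearised_stability)
  have sym: "sym (edges N)"
    using tree by (auto simp: hierarchical_tree_def sym_def)
  \<comment> \<open>The feedback part is constant in z, so continuity concerns
    \<open>A_tilde\<close> alone; at z = 0 this is the matrix of the spectral hypothesis.\<close>
  let ?J = "\<lambda>z. A_tilde N c (state_at g c xs z) + B_full N c ** F_full N g c Quu Q Qg"
  show "((\<lambda>z. controlled_field N g c xs z (F_full N g c Quu Q Qg *v z)) has_derivative (\<lambda>h. ?J z *v h)) (at z)" for z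
    by (rule controlled_field_has_derivative[OF coords lossless sym])
  show "isCont ?J 0"
    by (intro continuous_intros continuous_A_tilde)
  show "spec (?J 0) \<subseteq> left_half_plane"
    using hurwitz by (simp add: state_at_0)
  show "controlled_field N g c xs 0 (F_full N g c Quu Q Qg *v 0) = 0"
    using controlled_field_equilibrium[OF sync lossless sym] by simp
qed

end
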